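(* Let $p=p(n)\in(0,1)$ with $\limsup_{n\to\infty}p<1$, and let $K_{n,p}$ denote the number of edges of a unimodular triangulation of the random symmetric edge polytope $P_{n,p}$. Then $$\mathbb{V}(K_{n,p})\gtrsim\begin{cases} n^6p^3, & \text{if } p\gg n^{-2},\\ n^2p, & \text{if } p\lesssim n^{-2}.\end{cases}$$
   Context: For a finite simple graph $G=(V,E)$ (elements of $V$ are nodes, elements of $E\subseteq\binom V2$ are arcs), with $(\mathbf{e}_i)_{i\in V}$ the standard basis of $\mathbb{R}^V$, the symmetric edge polytope is $P_G:=\operatorname{conv}\{\pm(\mathbf{e}_i-\mathbf{e}_j):\{i,j\}\in E\}\subset\mathbb{R}^V$ (empty if $E=\emptyset$, in which case the number of edges of a triangulation is $0$). A (lattice) triangulation of a $d$-dimensional lattice polytope $P$ is a subdivision of $P$ into $d$-dimensional lattice simplices with union $P$, any two of which meet in a (possibly empty) common face. It is unimodular if every $d$-simplex in it is lattice equivalent (with respect to the lattice $\mathbb{Z}^V\cap\operatorname{aff}(P)$) to the standard simplex spanned by the origin and the standard unit vectors, i.e. has normalized minimal volume. The edges of a triangulation are the $1$-dimensional elements of the simplicial complex consisting of its simplices and all their faces. It is known that every $P_G$ has a unimodular triangulation, and that all unimodular triangulations of a given lattice polytope have the same number of edges, so $K_{n,p}$ is well defined. It is also known that for any total order $\prec$ on the arcs of $G$ there is a unimodular triangulation of $P_G$, with vertices the origin and the vertices of $P_G$, in which two vertices $\mathbf{x},\mathbf{y}$ form an edge if and only if: one of them is the origin; or (identifying $\mathbf{e}_i-\mathbf{e}_j$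 with the directed arc $i\to j$) they are not antipodal, no directed $3$-cycle in $G$ contains both corresponding directed arcs, and for every directed $4$-cycle of $G$ containing both, the $\prec$-minimal arc of that cycle is one of the arcs corresponding to $\mathbf{x}$ or $\mathbf{y}$. $G_{n,p}$ is the Erdős–Rényi random graph on node set $[n]$, each arc of the complete graph being retained independently with probability $p=p(n)\in(0,1)$; $P_{n,p}:=P_{G_{n,p}}$. $\mathbb{V}$ denotes variance. Asymptotic notation for sequences (as $n\to\infty$): $a_n\gg b_n$ means $\liminf|a_n/b_n|=\infty$; $a_n\lesssim b_n$ means $\limsup|a_n/b_n|<\infty$; $a_n\gtrsim b_n$ means $\liminf|a_n/b_n|>0$. A case distinction means: if the sequence $p=p(n)$ satisfies the asymptotic condition, then the corresponding relation holds. *)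

theory Defs
  imports "HOL-Analysis.Finite_Function_Topology" "HOL-Probability.Probability"
begin

text \<open>
  The number of nodes varies within the statement, so vectors live in the real vector space
  of finitely supported functions \<^typ>\<open>'v \<Rightarrow>\<^sub>0 real\<close>.  The space \<open>\<real>\<^sup>V\<close> is the
  subspace of vectors supported in \<open>V\<close>; all notions below depend only on the affine hull of
  the polytope, which is contained in \<open>\<real>\<^sup>V\<close>.  The library's \<open>aff_dim\<close> and \<open>simplex\<close> are
  restricted to the class \<open>euclidean_space\<close>, hence the counterparts here.
\<close>

definition unit_vec :: "'v \<Rightarrow> ('v \<Rightarrow>\<^sub>0 real)"
  where "unit_vec i = Poly_Mapping.single i 1"

definition int_points :: "('v \<Rightarrow>\<^sub>0 real) set"
  where "int_points = {x. \<forall>i. Poly_Mapping.lookup x i \<in> \<int>}"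

text \<open>The set of arcs is symmetric in \<open>i\<close> and \<open>j\<close>, so both signs of each generator occur.\<close>

definition sym_edge_polytope :: "'v set set \<Rightarrow> ('v \<Rightarrow>\<^sub>0 real) set"
  where "sym_edge_polytope E = convex hull {unit_vec i - unit_vec j | i j. {i, j} \<in> E}"

text \<open>As for \<open>aff_dim\<close>, the empty set has dimension \<open>-1\<close>.\<close>

definition has_affine_dim :: "'a::real_vector set \<Rightarrow> int \<Rightarrow> bool"
  where "has_affine_dim S d \<longleftrightarrow>
    (\<exists>B. finite B \<and> \<not> affine_dependent B \<and> affine hull B = affine hull S \<and> int (card B) = d + 1)"

definition lattice_simplex :: "int \<Rightarrow> ('v \<Rightarrow>\<^sub>0 real) set \<Rightarrow> bool"
  where "lattice_simplex d S \<longleftrightarrow>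
    (\<exists>C. finite C \<and> C \<subseteq> int_points \<and> \<not> affine_dependent C \<and> int (card C) = d + 1 \<and>
         S = convex hull C)"

definition lattice_triangulation :: "('v \<Rightarrow>\<^sub>0 real) set \<Rightarrow> ('v \<Rightarrow>\<^sub>0 real) set set \<Rightarrow> bool"
  where "lattice_triangulation P T \<longleftrightarrow>
    finite T \<and> \<Union>T = P \<and>
    (\<exists>d. has_affine_dim P d \<and> (\<forall>S\<in>T. lattice_simplex d S)) \<and>
    (\<forall>S\<in>T. \<forall>S'\<in>T. (S \<inter> S') face_of S \<and> (S \<inter> S') face_of S')"

text \<open>\<open>coord_space d\<close> is \<open>\<real>\<^sup>d\<close>, with coordinates indexed by \<open>0, \<dots>, d - 1\<close>.\<close>

definition coord_space :: "nat \<Rightarrow> (nat \<Rightarrow>\<^sub>0 real) set"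
  where "coord_space d = {x. Poly_Mapping.keys x \<subseteq> {..<d}}"

definition standard_simplex :: "nat \<Rightarrow> (nat \<Rightarrow>\<^sub>0 real) set"
  where "standard_simplex d = convex hull (insert 0 (unit_vec ` {..<d}))"

definition affine_map_on :: "'a::real_vector set \<Rightarrow> ('a \<Rightarrow> 'b::real_vector) \<Rightarrow> bool"
  where "affine_map_on A f \<longleftrightarrow>
    (\<forall>x\<in>A. \<forall>y\<in>A. \<forall>u. f ((1 - u) *\<^sub>R x + u *\<^sub>R y) = (1 - u) *\<^sub>R f x + u *\<^sub>R f y)"

text \<open>
  Lattice equivalence of \<open>S \<subseteq> A\<close> and \<open>S' \<subseteq> A'\<close>, where \<open>A\<close> and \<open>A'\<close> are affine subspaces
  carrying the lattices of their integral points.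
\<close>

definition lattice_equivalent ::
  "('v \<Rightarrow>\<^sub>0 real) set \<Rightarrow> ('v \<Rightarrow>\<^sub>0 real) set \<Rightarrow> ('w \<Rightarrow>\<^sub>0 real) set \<Rightarrow> ('w \<Rightarrow>\<^sub>0 real) set \<Rightarrow> bool"
  where "lattice_equivalent A S A' S' \<longleftrightarrow>
    (\<exists>f. affine_map_on A f \<and> bij_betw f A A' \<and>
         f ` (A \<inter> int_points) = A' \<inter> int_points \<and> f ` S = S')"

definition unimodular_triangulation :: "('v \<Rightarrow>\<^sub>0 real) set \<Rightarrow> ('v \<Rightarrow>\<^sub>0 real) set set \<Rightarrow> bool"
  where "unimodular_triangulation P T \<longleftrightarrow>
    lattice_triangulation P T \<and>
    (\<forall>S\<in>T. \<exists>d. lattice_equivalent (affine hull P) S (coord_space d) (standard_simplex d))"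

definition triangulation_edges :: "('v \<Rightarrow>\<^sub>0 real) set set \<Rightarrow> ('v \<Rightarrow>\<^sub>0 real) set set"
  where "triangulation_edges T = {F. \<exists>S\<in>T. F face_of S \<and> has_affine_dim F 1}"

definition complete_arcs :: "nat \<Rightarrow> nat set set"
  where "complete_arcs n = {e. e \<subseteq> {1..n} \<and> card e = 2}"

text \<open>
  The Erdos-Renyi graph on \<open>{1..n}\<close>, as a distribution on arc sets: the independent Bernoulli
  variables \<open>\<omega> e\<close> decide which arcs of the complete graph are retained.
\<close>

definition random_graph :: "nat \<Rightarrow> real \<Rightarrow> nat set set pmf"
  where "random_graph n q =
    map_pmf (\<lambda>\<omega>. {e \<in> complete_arcs n. \<omega> e})
      (Pi_pmf (complete_arcs n) False (\<lambda>_. bernoulli_pmf q))"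

definition asymp_much_greater :: "(nat \<Rightarrow> real) \<Rightarrow> (nat \<Rightarrow> real) \<Rightarrow> bool" (infix \<open>\<ggreater>\<close> 50)
  where "a \<ggreater> b \<longleftrightarrow> liminf (\<lambda>n. ereal \<bar>a n / b n\<bar>) = \<infinity>"

definition asymp_lesssim :: "(nat \<Rightarrow> real) \<Rightarrow> (nat \<Rightarrow> real) \<Rightarrow> bool" (infix \<open>\<lesssim>\<close> 50)
  where "a \<lesssim> b \<longleftrightarrow> limsup (\<lambda>n. ereal \<bar>a n / b n\<bar>) < \<infinity>"

definition asymp_greatersim :: "(nat \<Rightarrow> real) \<Rightarrow> (nat \<Rightarrow> real) \<Rightarrow> bool" (infix \<open>\<greatersim>\<close> 50)
  where "a \<greatersim> b \<longleftrightarrow> liminf (\<lambda>n. ereal \<bar>a n / b n\<bar>) > 0"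

end

theory Submission
  imports Defs
begin

text \<open>
  In a unimodular triangulation \<open>T\<close> of a lattice polytope \<open>P\<close> containing the origin, every lattice
  point of \<open>2P\<close> is \<open>v + w\<close> for vertices \<open>v\<close>, \<open>w\<close> of a common simplex, and \<open>{v, w}\<close> is determined
  by \<open>v + w\<close>.  Hence the number of edges of \<open>T\<close> is \<open>\<bar>(L + L) - 2L\<bar>\<close>, where \<open>L\<close> is the set of lattice
  points of \<open>P\<close>, and no particular triangulation has to be constructed.  For \<open>P = P\<^sub>G\<close> with at least
  one arc, \<open>L\<close> consists of the origin and the vectors \<open>e\<^sub>i - e\<^sub>j\<close> of the arcs, and \<open>(L + L) - 2L\<close>
  grows with the arc set.  Inserting an arc \<open>ab\<close> creates the vectors
  \<open>e\<^sub>a - e\<^sub>b + e\<^sub>k - e\<^sub>l\<close> for the arcs \<open>kl\<close> disjoint from \<open>ab\<close> such that \<open>al\<close> is not an arc, and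
  also \<open>e\<^sub>a - e\<^sub>b\<close> if \<open>a\<close> was isolated.  The expected increment \<open>\<delta>\<close> is therefore at least
  \<open>(n - 2)(n - 3)p(1 - p)\<close> and at least \<open>1 - np\<close>.  If \<open>Y\<close> is the centred number of arcs, then
  expanding \<open>E(K - EK - \<delta>Y)\<^sup>2 \<ge> 0\<close> gives variance at least \<open>(n choose 2) p (1 - p) \<delta>\<^sup>2\<close>.
\<close>

subsection \<open>Unimodular simplices\<close>

lemma lookup_scaleR [simp]:
  fixes x :: "'v \<Rightarrow>\<^sub>0 'a::real_vector"
  shows "Poly_Mapping.lookup (r *\<^sub>R x) i = r *\<^sub>R Poly_Mapping.lookup x i"
proof -
  have "finite {i. r *\<^sub>R Poly_Mapping.lookup x i \<noteq> 0}"
    by (rule finite_subset[OF _ finite_lookup[of x]]) auto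
  then show ?thesis
    by (simp add: scaleR_poly_mapping_def)
qed

lemma lookup_unit_vec: "Poly_Mapping.lookup (unit_vec i) j = (if i = j then 1 else 0)"
  by (simp add: unit_vec_def lookup_single when_def)

lemma unit_vec_eq_iff [simp]: "unit_vec i = unit_vec j \<longleftrightarrow> i = j"
  by (metis lookup_unit_vec zero_neq_one)

lemma unit_vec_nonzero [simp]: "unit_vec i \<noteq> 0" "0 \<noteq> unit_vec i"
  by (metis lookup_unit_vec lookup_zero zero_neq_one)+

lemma unit_vec_in_int_points [simp]: "unit_vec i \<in> int_points"
  by (simp add: int_points_def lookup_unit_vec)

lemma zero_in_int_points [simp]: "0 \<in> int_points"
  by (simp add: int_points_def)

lemma int_points_add: "x \<in> int_points \<Longrightarrow> y \<in> int_points \<Longrightarrow> x + y \<in> int_points"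
  by (simp add: int_points_def lookup_add)

lemma int_points_diff: "x \<in> int_points \<Longrightarrow> y \<in> int_points \<Longrightarrow> x - y \<in> int_points"
  by (simp add: int_points_def lookup_minus)

section \<open>The coordinate space and its unit vectors\<close>

lemma subspace_coord_space: "subspace (coord_space d)"
  by (auto intro!: subspaceI dest!: subsetD[OF keys_add] simp: coord_space_def) (auto simp: in_keys_iff subset_iff)

lemma unit_vec_in_coord_space: "i < d \<Longrightarrow> unit_vec i \<in> coord_space d"
  by (auto simp: coord_space_def in_keys_iff lookup_unit_vec split: if_splits)

lemma coord_space_expand:
  assumes "z \<in> coord_space d"
  shows "z = (\<Sum>i<d. Poly_Mapping.lookup z i *\<^sub>R unit_vec i)"
proof (rule poly_mapping_eqI)
  fix k
  have "k \<ge> d \<Longrightarrow> Poly_Mapping.lookup z k = 0"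
    using assms by (auto simp: coord_space_def in_keys_iff subset_iff not_less[symmetric])
  then show "Poly_Mapping.lookup z k = Poly_Mapping.lookup (\<Sum>i<d. Poly_Mapping.lookup z i *\<^sub>R unit_vec i) k"
    by (cases "k < d") (auto simp: lookup_sum lookup_unit_vec mult_delta_right)
qed

lemma independent_unit_vec: "independent (unit_vec ` {..<d::nat})"
proof -
  have "u j = 0" if u: "(\<Sum>v\<in>unit_vec ` {..<d}. u v *\<^sub>R v) = 0" and j: "j \<in> unit_vec ` {..<d}" for u j
  proof -
    obtain k where k: "j = unit_vec k" "k < d" using j by auto
    have "(\<Sum>i<d. u (unit_vec i) *\<^sub>R unit_vec i) = 0"
      using u by (simp add: sum.reindex inj_on_def)
    then have "0 = Poly_Mapping.lookup (\<Sum>i<d. u (unit_vec i) *\<^sub>R unit_vec i) k"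
      by simp
    also have "\<dots> = u j" using k by (simp add: lookup_sum lookup_unit_vec mult_delta_right)
    finally show ?thesis by simp
  qed
  then show ?thesis by (subst dependent_finite) auto
qed

text \<open>The difference of two such coefficient families is an affine dependency. The total
  weight need not be 1, so that combinations of total weight 2 are covered as well.\<close>

lemma affine_independent_unique:
  fixes C :: "'a::real_vector set"
  assumes "finite C" "\<not> affine_dependent C" "sum u C = sum w C"
    and "(\<Sum>v\<in>C. u v *\<^sub>R v) = (\<Sum>v\<in>C. w v *\<^sub>R v)" "v \<in> C"
  shows "u v = w v"
proof (rule ccontr)
  assume "u v \<noteq> w v"
  then have "affine_dependent C"
    unfolding affine_dependent_explicit_finite[OF assms(1)] using assms(3-5)
    by (intro exI[of _ "\<lambda>v. u v - w v"]) (auto simp: sum_subtractf scaleR_diff_left)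
  with assms(2) show False by simp
qed

text \<open>\<open>affine_map_on\<close> is a condition on two points at a time. Scaling comes from
  the line through \<open>0\<close> and \<open>x\<close>, additivity from the midpoint of
  \<open>x\<close> and \<open>y\<close>; together they make \<open>g - g 0\<close> linear on
  \<open>V\<close>.\<close>

lemma affine_map_on_subspace:
  assumes g: "affine_map_on V g" and V: "subspace V"
  shows "x \<in> V \<Longrightarrow> g (t *\<^sub>R x) = g 0 + t *\<^sub>R (g x - g 0)"
    and "x \<in> V \<Longrightarrow> y \<in> V \<Longrightarrow> g (x + y) = g x + g y - g 0"
proof -
  have 0: "0 \<in> V" using V by (rule subspace_0)
  have aff: "g ((1 - u) *\<^sub>R x + u *\<^sub>R y) = (1 - u) *\<^sub>R g x + u *\<^sub>R g y"
    if "x \<in> V" "y \<in> V" for x y u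
    using g that by (simp add: affine_map_on_def)
  show *: "g (t *\<^sub>R x) = g 0 + t *\<^sub>R (g x - g 0)" if "x \<in> V" for t x
    using aff[OF 0 that, of t] by (simp add: algebra_simps)
  show "g (x + y) = g x + g y - g 0" if xy: "x \<in> V" "y \<in> V" for x y
  proof -
    let ?m = "(1 - 1/2) *\<^sub>R x + (1/2) *\<^sub>R y"
    have m: "?m \<in> V" using xy V by (simp add: subspace_add subspace_scale)
    have "x + y = 2 *\<^sub>R ?m" by (simp add: algebra_simps flip: scaleR_add_left)
    then have "g (x + y) = g 0 + 2 *\<^sub>R (g ?m - g 0)" using *[OF m] by metis
    also have "g ?m = (1/2) *\<^sub>R (g x + g y)"
      unfolding aff[OF xy] by (simp add: algebra_simps)
    finally show ?thesis by (simp add: algebra_simps scaleR_2)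
  qed
qed

lemma affine_map_on_sum:
  assumes g: "affine_map_on V g" and V: "subspace V" and "finite I" "\<And>i. i \<in> I \<Longrightarrow> b i \<in> V"
  shows "g (\<Sum>i\<in>I. t i *\<^sub>R b i) = g 0 + (\<Sum>i\<in>I. t i *\<^sub>R (g (b i) - g 0))"
  using assms(3,4)
proof (induction rule: finite_induct)
  case (insert k I)
  have "(\<Sum>i\<in>I. t i *\<^sub>R b i) \<in> V" "t k *\<^sub>R b k \<in> V"
    using insert V by (auto intro!: subspace_sum subspace_scale)
  then show ?case
    using insert by (simp add: affine_map_on_subspace[OF g V])
qed simp

text \<open>The vertices of the standard simplex and the integral coordinates of lattice points are
  pulled back along the lattice equivalence. What unimodularity provides later is the last
  conclusion: the vertices generate all lattice points of \<open>A\<close> by integral affine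
  combinations.\<close>

lemma unimodular_simplexE:
  assumes A: "affine A" and S: "S \<subseteq> A" and eq: "lattice_equivalent A S (coord_space d) (standard_simplex d)"
  obtains C where "finite C" "C \<subseteq> A \<inter> int_points" "\<not> affine_dependent C" "S = convex hull C"
    "\<And>x. x \<in> A \<inter> int_points \<Longrightarrow> \<exists>u. (\<forall>v\<in>C. u v \<in> \<int>) \<and> sum u C = 1 \<and> (\<Sum>v\<in>C. u v *\<^sub>R v) = x"
proof -
  obtain f where f: "affine_map_on A f" "bij_betw f A (coord_space d)"
      "f ` (A \<inter> int_points) = coord_space d \<inter> int_points" "f ` S = standard_simplex d"
    using eq unfolding lattice_equivalent_def by blast
  let ?V = "coord_space d" and ?B = "insert 0 (unit_vec ` {..<d})"
  define g where "g = inv_into A f"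
  have gA: "g z \<in> A" and fg: "f (g z) = z" if "z \<in> ?V" for z
    unfolding g_def using f(2) that by (metis bij_betw_def inv_into_into, metis bij_betw_def f_inv_into_f)
  have gf: "g (f x) = x" if "x \<in> A" for x
    using f(2) that by (auto simp: g_def bij_betw_def)
  note V = subspace_coord_space[of d]
  have g: "affine_map_on ?V g"
    unfolding affine_map_on_def
  proof (intro ballI allI)
    fix x y u assume xy: "x \<in> ?V" "y \<in> ?V"
    have "f ((1 - u) *\<^sub>R g x + u *\<^sub>R g y) = (1 - u) *\<^sub>R x + u *\<^sub>R y"
      using f(1) xy gA fg by (simp add: affine_map_on_def)
    moreover have "(1 - u) *\<^sub>R g x + u *\<^sub>R g y \<in> A"
      using mem_affine[OF A gA[OF xy(1)] gA[OF xy(2)]] by simp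
    ultimately show "g ((1 - u) *\<^sub>R x + u *\<^sub>R y) = (1 - u) *\<^sub>R g x + u *\<^sub>R g y"
      using gf by metis
  qed
  \<comment> \<open>The linear part of \<open>g\<close>, extended to the whole space by ignoring the
    coordinates from \<open>d\<close> on. Images of convex hulls and of independent sets can then be
    treated with a globally linear map.\<close>
  define h where "h z = (\<Sum>i<d. Poly_Mapping.lookup z i *\<^sub>R (g (unit_vec i) - g 0))" for z
  have h: "linear h"
    by (rule linearI) (simp_all add: h_def lookup_add scaleR_add_left sum.distrib scaleR_sum_right)
  have gh: "g 0 + h z = g z" if "z \<in> ?V" for z
    using affine_map_on_sum[OF g V, of "{..<d}" unit_vec "Poly_Mapping.lookup z"]
    by (simp add: unit_vec_in_coord_space h_def flip: coord_space_expand[OF that])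
  have BV: "?B \<subseteq> ?V"
    using V by (auto simp: subspace_0 unit_vec_in_coord_space)
  have convV: "convex hull ?B \<subseteq> ?V"
    using BV V by (simp add: hull_minimal subspace_imp_convex)
  have Bint: "?B \<subseteq> int_points" by auto
  define C where "C = (\<lambda>z. g 0 + h z) ` ?B"
  have CgB: "C = g ` ?B" unfolding C_def using gh BV by (intro image_cong) auto
  have injg: "inj_on g ?V" using fg by (rule inj_on_inverseI)
  have injh: "inj_on h ?V" using injg gh by (metis inj_on_def)
  show ?thesis
  proof (rule that[of C])
    show "finite C" by (simp add: C_def)
    have "g ` (?V \<inter> int_points) \<subseteq> A \<inter> int_points"
    proof
      fix y assume "y \<in> g ` (?V \<inter> int_points)"
      then have "y \<in> g ` f ` (A \<inter> int_points)" using f(3) by simp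
      then show "y \<in> A \<inter> int_points" using gf by auto
    qed
    with BV Bint show "C \<subseteq> A \<inter> int_points" unfolding CgB by blast
    have "0 \<notin> unit_vec ` {..<d}" by auto
    then have "C - {g 0} = (\<lambda>z. g 0 + h z) ` unit_vec ` {..<d}"
    proof -
      have "C - {g 0} = g ` unit_vec ` {..<d}"
        using inj_on_image_set_diff[OF injg, of ?B "{0}"] BV \<open>0 \<notin> _\<close>
        unfolding CgB by (simp add: insert_Diff_if)
      also have "\<dots> = (\<lambda>z. g 0 + h z) ` unit_vec ` {..<d}"
        using BV by (intro image_cong refl) (auto simp: gh)
      finally show ?thesis .
    qed
    then have "(\<lambda>x. - g 0 + x) ` (C - {g 0}) = h ` unit_vec ` {..<d}"
      by (simp add: image_image)
    moreover have "independent (h ` unit_vec ` {..<d})"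
    proof (rule linear_independent_injective_image)
      show "inj_on h (span (unit_vec ` {..<d}))"
        using injh V BV by (meson inj_on_subset insert_subset span_minimal)
    qed (use h independent_unit_vec in auto)
    moreover have "g 0 \<in> C" by (simp add: CgB)
    ultimately show "\<not> affine_dependent C"
      by (simp add: affine_dependent_iff_dependent2)
    have "S = g ` f ` S" using gf S by (force simp: image_image)
    also have "\<dots> = (\<lambda>z. g 0 + h z) ` (convex hull ?B)"
      unfolding f(4) standard_simplex_def using gh convV by (intro image_cong) auto
    also have "\<dots> = (+) (g 0) ` h ` (convex hull ?B)" by (simp only: image_image)
    also have "\<dots> = convex hull C"
      unfolding C_def convex_hull_linear_image[OF h] convex_hull_translation[symmetric]
      by (simp only: image_image)
    finally show "S = convex hull C" .
    show "\<exists>u. (\<forall>v\<in>C. u v \<in> \<int>) \<and> sum u C = 1 \<and> (\<Sum>v\<in>C. u v *\<^sub>R v) = x"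
      if x: "x \<in> A \<inter> int_points" for x
    proof -
      define z where "z = f x"
      have z: "z \<in> ?V" "z \<in> int_points" using f(3) x unfolding z_def by blast+
      \<comment> \<open>The affine coordinates of \<open>z\<close> at the vertices of the standard
        simplex: a unit vector picks out its own coordinate of \<open>z\<close>, and the origin
        receives the weight that is left.\<close>
      define w where "w b = (if b = 0 then 1 - (\<Sum>i<d. Poly_Mapping.lookup z i)
        else (\<Sum>i<d. Poly_Mapping.lookup z i * Poly_Mapping.lookup b i))" for b :: "nat \<Rightarrow>\<^sub>0 real"
      have wi: "w (unit_vec i) = Poly_Mapping.lookup z i" if "i < d" for i
        using that by (simp add: w_def lookup_unit_vec mult_delta_right)
      have sumB: "(\<Sum>b\<in>?B. q b) = q 0 + (\<Sum>i<d. q (unit_vec i))" for q :: "_ \<Rightarrow> 'x::comm_monoid_add"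
        by (simp add: sum.insert image_iff sum.reindex inj_on_def)
      have zint: "Poly_Mapping.lookup z i \<in> \<int>" for i
        using z(2) by (simp add: int_points_def)
      have wint: "w b \<in> \<int>" if "b \<in> ?B" for b
        using that zint by (auto simp: w_def lookup_unit_vec intro!: Ints_diff Ints_sum)
      have reC: "(\<Sum>v\<in>C. q v) = (\<Sum>b\<in>?B. q (g b))" for q :: "_ \<Rightarrow> 'x::comm_monoid_add"
        unfolding CgB using inj_on_subset[OF injg BV] by (simp only: sum.reindex o_def)
      have fgB: "f (g b) = b" if "b \<in> ?B" for b using fg BV that by auto
      have sumw: "sum w ?B = 1"
        unfolding sumB by (simp add: wi) (simp add: w_def)
      have "(\<Sum>b\<in>?B. w b *\<^sub>R g b) = (\<Sum>b\<in>?B. w b *\<^sub>R g 0 + h (w b *\<^sub>R b))"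
        using gh BV by (intro sum.cong) (auto simp: linear_cmul[OF h] simp flip: scaleR_add_right)
      also have "\<dots> = sum w ?B *\<^sub>R g 0 + h (\<Sum>b\<in>?B. w b *\<^sub>R b)"
        by (simp only: sum.distrib scaleR_sum_left linear_sum[OF h])
      also have "(\<Sum>b\<in>?B. w b *\<^sub>R b) = z"
        unfolding sumB by (simp add: wi flip: coord_space_expand[OF z(1)])
      also have "sum w ?B *\<^sub>R g 0 + h z = g z" using gh z(1) sumw by simp
      finally have *: "(\<Sum>b\<in>?B. w b *\<^sub>R g b) = x" using gf x z_def by simp
      show ?thesis
      proof (intro exI[of _ "w \<circ> f"] conjI ballI)
        show "(w \<circ> f) v \<in> \<int>" if "v \<in> C" for v using that wint fgB by (auto simp: CgB)
        have "(\<Sum>b\<in>?B. (w \<circ> f) (g b)) = sum w ?B" 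
          using fgB by (intro sum.cong) auto
        then show "sum (w \<circ> f) C = 1" by (simp only: reC sumw)
        have "(\<Sum>b\<in>?B. (w \<circ> f) (g b) *\<^sub>R g b) = (\<Sum>b\<in>?B. w b *\<^sub>R g b)" 
          using fgB by (intro sum.cong) auto
        then show "(\<Sum>v\<in>C. (w \<circ> f) v *\<^sub>R v) = x" by (simp only: reC *)
      qed
    qed
  qed
qed

subsection \<open>Edges of simplices\<close>

text \<open>Translating by a point of each set gives independent sets spanning the same space of
  directions. This lets \<open>has_affine_dim\<close> determine the number of vertices of a
  face.\<close>

lemma affine_independent_card_unique:
  fixes B C :: "'a::real_vector set"
  assumes "finite B" "finite C" "\<not> affine_dependent B" "\<not> affine_dependent C" "affine hull B = affine hull C"
  shows "card B = card C"
proof (cases "B = {} \<or> C = {}")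
  case True
  then show ?thesis using assms(5) by (metis affine_hull_eq_empty)
next
  case False
  then obtain b c where bc: "b \<in> B" "c \<in> C" by auto
  let ?D = "\<lambda>a X. (\<lambda>x. - a + x) ` (X - {a})"
  have c: "c \<in> affine hull B" using bc assms(5) by (simp add: hull_inc)
  have "span (?D b B) = span (?D c C)"
  proof -
    have hB: "affine hull B = (\<lambda>x. b + x) ` span (?D b B)" and hC: "affine hull C = (\<lambda>x. c + x) ` span (?D c C)"
      using bc by (simp_all only: affine_hull_span2)
    obtain s where s: "c = b + s" "s \<in> span (?D b B)" using c unfolding hB by auto
    have "x \<in> span (?D b B) \<longleftrightarrow> c + x \<in> affine hull B" for x
    proof -
      have "c + x \<in> affine hull B \<longleftrightarrow> s + x \<in> span (?D b B)"
        unfolding hB s(1) by (auto simp: image_iff add.assoc)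
      also have "\<dots> \<longleftrightarrow> x \<in> span (?D b B)"
        using s(2) span_add_eq by blast
      finally show ?thesis ..
    qed
    moreover have "x \<in> span (?D c C) \<longleftrightarrow> c + x \<in> affine hull C" for x
      unfolding hC by (auto simp: image_iff)
    ultimately show ?thesis using assms(5) by auto
  qed
  then have "dim (?D b B) = dim (?D c C)" by (metis dim_span)
  moreover have "independent (?D b B)" "independent (?D c C)"
    using assms bc affine_dependent_iff_dependent2 by blast+
  ultimately have "card (?D b B) = card (?D c C)"
    by (simp add: dim_eq_card_independent)
  then have *: "card (B - {b}) = card (C - {c})" by (simp add: card_image)
  then show ?thesis using assms(1,2) bc by (metis card.remove)
qed

text \<open>If a point \<open>x\<close> of the face gives a vertex \<open>v\<close> a weight
  strictly between 0 and 1, then \<open>x\<close> lies between \<open>v\<close> and the renormalised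
  rest \<open>y\<close>, so \<open>v\<close> belongs to the face. In the degenerate cases (weight 1,
  or \<open>y = v\<close>) the point \<open>x\<close> is \<open>v\<close> itself.\<close>

lemma face_of_convex_hull_finite:
  fixes C :: "'a::real_vector set"
  assumes C: "finite C" and F: "F face_of convex hull C"
  shows "F = convex hull (C \<inter> F)"
proof
  show "convex hull (C \<inter> F) \<subseteq> F"
    using F by (simp add: face_of_imp_convex hull_minimal)
  show "F \<subseteq> convex hull (C \<inter> F)"
  proof
    fix x assume x: "x \<in> F"
    then have "x \<in> convex hull C" using F face_of_imp_subset by blast
    then obtain u where u: "\<And>v. v \<in> C \<Longrightarrow> 0 \<le> u v" "sum u C = 1" "(\<Sum>v\<in>C. u v *\<^sub>R v) = x"
      unfolding convex_hull_finite[OF C] by auto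
    have "v \<in> F" if v: "v \<in> C" "u v \<noteq> 0" for v
    proof -
      have rem: "sum u C = u v + sum u (C - {v})" "x = u v *\<^sub>R v + (\<Sum>v\<in>C-{v}. u v *\<^sub>R v)"
        using C v by (simp_all add: sum.remove flip: u(3))
      show ?thesis
      proof (cases "u v = 1")
        case True
        then have "sum u (C - {v}) = 0" using rem u(2) by simp
        then have "\<forall>w\<in>C - {v}. u w = 0" using C u(1) by (subst (asm) sum_nonneg_eq_0_iff) auto
        then have "x = v" using rem True by simp
        then show ?thesis using x by simp
      next
        case False
        have lt: "0 < u v" "u v < 1" 
          using u(1)[OF v(1)] v(2) False rem(1) u sum_nonneg[of "C - {v}" u] by (auto simp: less_le)
        define y where "y = (\<Sum>w\<in>C-{v}. (u w / (1 - u v)) *\<^sub>R w)"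
        have "y \<in> convex hull (C - {v})"
          unfolding convex_hull_finite[OF finite_Diff[OF C]] y_def using u(1) lt rem(1) u(2)
          by (intro CollectI exI[of _ "\<lambda>w. u w / (1 - u v)"]) (auto simp flip: sum_divide_distrib)
        then have y: "y \<in> convex hull C" using hull_mono[of "C - {v}" C] by blast
        have "(1 - u v) *\<^sub>R y = (\<Sum>v\<in>C-{v}. u v *\<^sub>R v)"
          unfolding y_def scaleR_sum_right using lt by (intro sum.cong) auto
        then have xy: "x = (1 - u v) *\<^sub>R y + u v *\<^sub>R v" using rem by simp
        show ?thesis
        proof (cases "y = v")
          case True
          then have "x = v" using xy by (simp flip: scaleR_add_left)
          then show ?thesis using x by simp
        next
          case False
          then have "x \<in> open_segment y v" using xy lt by (auto simp: in_segment)
          then show ?thesis using face_ofD[OF F _ y _ x] v by (simp add: hull_inc)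
        qed
      qed
    qed
    then have z: "u v = 0" if "v \<in> C - C \<inter> F" for v using that by auto
    have "sum u (C \<inter> F) = 1" "(\<Sum>v\<in>C \<inter> F. u v *\<^sub>R v) = x"
      using u(2,3) z C by (auto simp: sum.mono_neutral_right[of C "C \<inter> F"])
    then show "x \<in> convex hull (C \<inter> F)"
      using C u(1) by (subst convex_hull_finite) auto
  qed
qed

lemma affine_independent_edge_iff:
  fixes C :: "'a::real_vector set"
  assumes C: "finite C" "\<not> affine_dependent C"
  shows "F face_of convex hull C \<and> has_affine_dim F 1 \<longleftrightarrow>
         (\<exists>v\<in>C. \<exists>w\<in>C. v \<noteq> w \<and> F = convex hull {v, w})" (is "?L \<longleftrightarrow> ?R")
proof
  assume L: ?L
  then obtain B where B: "finite B" "\<not> affine_dependent B" "affine hull B = affine hull F" "int (card B) = 1 + 1"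
    unfolding has_affine_dim_def by auto
  have F: "F = convex hull (C \<inter> F)" using L C by (simp add: face_of_convex_hull_finite)
  have "affine hull F = affine hull (C \<inter> F)"
    by (metis F affine_hull_convex_hull)
  then have "card (C \<inter> F) = 2"
    using affine_independent_card_unique[of B "C \<inter> F"] B C(1) affine_independent_subset[OF C(2), of "C \<inter> F"] by simp
  then obtain v w where "C \<inter> F = {v, w}" "v \<noteq> w" by (auto simp: card_2_iff)
  then show ?R using F by (metis Int_iff insertCI)
next
  assume ?R
  then obtain v w where vw: "v \<in> C" "w \<in> C" "v \<noteq> w" and F: "F = convex hull {v, w}" by auto
  have "has_affine_dim F 1"
    unfolding has_affine_dim_def F
    using vw(3) by (intro exI[of _ "{v, w}"]) simp
  moreover have "F face_of convex hull C"
    unfolding F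
  proof (rule face_of_convex_hulls)
    \<comment> \<open>A common point would have two families of affine coordinates with disjoint
      supports; by uniqueness both would vanish, although each sums to 1.\<close>
    show "affine hull {v, w} \<inter> convex hull (C - {v, w}) = {}"
    proof (rule ccontr)
      assume "affine hull {v, w} \<inter> convex hull (C - {v, w}) \<noteq> {}"
      then obtain x where x: "x \<in> affine hull {v, w}" "x \<in> convex hull (C - {v, w})" by auto
      obtain a where a: "sum a {v, w} = 1" "(\<Sum>z\<in>{v, w}. a z *\<^sub>R z) = x"
        using x(1) by (subst (asm) affine_hull_finite) auto
      obtain b where b: "sum b (C - {v, w}) = 1" "(\<Sum>z\<in>C - {v, w}. b z *\<^sub>R z) = x"
        using x(2) C(1) by (subst (asm) convex_hull_finite) auto
      let ?a = "\<lambda>z. if z \<in> {v, w} then a z else 0" and ?b = "\<lambda>z. if z \<in> {v, w} then 0 else b z"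
      have "sum ?a C = sum a {v, w}" "(\<Sum>z\<in>C. ?a z *\<^sub>R z) = (\<Sum>z\<in>{v, w}. a z *\<^sub>R z)"
        by ((rule sum.mono_neutral_cong_right; use C vw in auto)[1])+
      moreover have "sum ?b C = sum b (C - {v, w})" "(\<Sum>z\<in>C. ?b z *\<^sub>R z) = (\<Sum>z\<in>C - {v, w}. b z *\<^sub>R z)"
        by ((rule sum.mono_neutral_cong_right; use C vw in auto)[1])+
      ultimately have "?a z = ?b z" if "z \<in> C" for z
        using affine_independent_unique[OF C, of ?a ?b z] that a b by simp
      then have "a v = 0" "a w = 0" using vw by fastforce+
      then show False using a(1) vw(3) by simp
    qed
  qed (use C vw in auto)
  ultimately show ?L by blast
qed

subsection \<open>Lattice points of dilated unimodular simplices\<close>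

text \<open>The sum \<open>v + w\<close> has the coordinates \<open>\<delta> v + \<delta> w\<close>
  of total weight 2, and these are unique, so the pair can be read off from them.\<close>

lemma affine_independent_sum_pair:
  fixes C :: "'a::real_vector set"
  assumes C: "finite C" "\<not> affine_dependent C"
    and vw: "v \<in> C" "w \<in> C" "v' \<in> C" "w' \<in> C" "v + w = v' + w'"
  shows "{v, w} = {v', w'}"
proof -
  define \<delta> where "\<delta> a z = (if z = a then 1 else 0 :: real)" for a z :: 'a
  have \<delta>: "sum (\<delta> a) C = 1" "(\<Sum>z\<in>C. \<delta> a z *\<^sub>R z) = a" if "a \<in> C" for a
    using C(1) that by (simp_all add: \<delta>_def if_distrib[of "\<lambda>x. x *\<^sub>R _"] cong: if_cong)
  have eq: "\<delta> v z + \<delta> w z = \<delta> v' z + \<delta> w' z" if "z \<in> C" for z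
  proof (rule affine_independent_unique[OF C _ _ that])
    show "(\<Sum>z\<in>C. \<delta> v z + \<delta> w z) = (\<Sum>z\<in>C. \<delta> v' z + \<delta> w' z)"
      using vw by (simp add: sum.distrib \<delta>)
    show "(\<Sum>z\<in>C. (\<delta> v z + \<delta> w z) *\<^sub>R z) = (\<Sum>z\<in>C. (\<delta> v' z + \<delta> w' z) *\<^sub>R z)"
      using vw by (simp add: sum.distrib \<delta> scaleR_add_left)
  qed
  show ?thesis
    using eq[OF vw(1)] eq[OF vw(2)] eq[OF vw(3)] eq[OF vw(4)]
    by (auto simp: \<delta>_def split: if_splits)
qed

lemma Ints_nonneg_sum_1:
  fixes c :: "'a \<Rightarrow> real"
  assumes "finite C" "\<And>v. v \<in> C \<Longrightarrow> c v \<in> \<int>" "\<And>v. v \<in> C \<Longrightarrow> 0 \<le> c v" "sum c C = 1"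
  obtains v where "v \<in> C" "c v = 1" "\<And>w. w \<in> C \<Longrightarrow> w \<noteq> v \<Longrightarrow> c w = 0"
proof -
  have "\<exists>v\<in>C. c v \<noteq> 0" using assms(4) by (metis sum.neutral zero_neq_one)
  then obtain v where v: "v \<in> C" "c v \<noteq> 0" by auto
  then have "c v \<ge> 1"
    using assms(2,3)[OF v(1)] by (auto elim!: Ints_cases)
  moreover have rem: "1 = c v + sum c (C - {v})"
    using assms(1,4) v(1) by (simp add: sum.remove)
  moreover have "sum c (C - {v}) \<ge> 0" by (intro sum_nonneg) (use assms(3) in auto)
  ultimately have "c v = 1" "sum c (C - {v}) = 0" by linarith+
  moreover from this have "\<forall>w\<in>C - {v}. c w = 0"
    using assms(1,3) by (subst (asm) sum_nonneg_eq_0_iff) auto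
  ultimately show ?thesis using that v by auto
qed

text \<open>Lowering one positive weight by 1 leaves nonnegative integral weights of sum 1, which
  are concentrated at a single point. The points \<open>v\<close> and \<open>w\<close> may
  coincide.\<close>

lemma Ints_nonneg_sum_2:
  fixes c :: "'a \<Rightarrow> real"
  assumes "finite C" "\<And>v. v \<in> C \<Longrightarrow> c v \<in> \<int>" "\<And>v. v \<in> C \<Longrightarrow> 0 \<le> c v" "sum c C = 2"
  obtains v w where "v \<in> C" "w \<in> C" "\<And>z. z \<in> C \<Longrightarrow> c z = (if z = v then 1 else 0) + (if z = w then 1 else 0)"
proof -
  have "\<exists>v\<in>C. c v \<noteq> 0" using assms(4) by (metis sum.neutral zero_neq_numeral)
  then obtain v where v: "v \<in> C" "c v \<noteq> 0" by auto
  then have "c v \<ge> 1"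
    using assms(2,3)[OF v(1)] by (auto elim!: Ints_cases)
  let ?d = "\<lambda>z. c z - (if z = v then 1 else 0)"
  have "sum ?d C = 1" using v assms(1,4) by (simp add: sum_subtractf)
  then obtain w where "w \<in> C" "?d w = 1" "\<And>z. z \<in> C \<Longrightarrow> z \<noteq> w \<Longrightarrow> ?d z = 0"
    using Ints_nonneg_sum_1[of C ?d] assms(1,2,3) \<open>c v \<ge> 1\<close> by (smt (verit) Ints_diff Ints_1 Ints_0)
  then show ?thesis using that[of v w] v by (smt (verit))
qed

text \<open>The form in which unimodularity is used. \<open>A\<close> is a linear subspace, so that
  doubling a point and subtracting lattice points do not leave it.\<close>

locale unimodular_simplex =
  fixes A :: "('v \<Rightarrow>\<^sub>0 real) set" and S C
  assumes subspace_A: "subspace A"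
    and finite_C: "finite C" and C_lattice: "C \<subseteq> A \<inter> int_points"
    and indep_C: "\<not> affine_dependent C"
    and S_eq: "S = convex hull C"
    and generates: "\<And>x. x \<in> A \<inter> int_points \<Longrightarrow>
      \<exists>u. (\<forall>v\<in>C. u v \<in> \<int>) \<and> sum u C = 1 \<and> (\<Sum>v\<in>C. u v *\<^sub>R v) = x"
begin

lemma S_subset_A: "S \<subseteq> A"
  unfolding S_eq using C_lattice subspace_A by (simp add: hull_minimal subspace_imp_convex)

text \<open>The convex coordinates of a lattice point of \<open>S\<close> agree with its integral
  affine coordinates; nonnegative integers of sum 1 single out one vertex.\<close>

lemma lattice_points: "S \<inter> int_points = C"
proof
  show "C \<subseteq> S \<inter> int_points" using C_lattice by (auto simp: S_eq hull_inc)
  show "S \<inter> int_points \<subseteq> C"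
  proof
    fix x assume x: "x \<in> S \<inter> int_points"
    then obtain t where t: "\<And>v. v \<in> C \<Longrightarrow> 0 \<le> t v" "sum t C = 1" "(\<Sum>v\<in>C. t v *\<^sub>R v) = x"
      unfolding S_eq convex_hull_finite[OF finite_C] by auto
    obtain u where u: "\<And>v. v \<in> C \<Longrightarrow> u v \<in> \<int>" "sum u C = 1" "(\<Sum>v\<in>C. u v *\<^sub>R v) = x"
      using generates[of x] x S_subset_A by blast
    have "t v = u v" if "v \<in> C" for v
      using affine_independent_unique[OF finite_C indep_C _ _ that] t u by simp
    then obtain v where v: "v \<in> C" "t v = 1" "\<And>w. w \<in> C \<Longrightarrow> w \<noteq> v \<Longrightarrow> t w = 0"
      using Ints_nonneg_sum_1[OF finite_C _ t(1,2)] u(1) by metis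
    have "x = (\<Sum>w\<in>C. (if w = v then v else 0))"
      unfolding t(3)[symmetric] using v by (intro sum.cong) auto
    then show "x \<in> C" using v finite_C by simp
  qed
qed

lemma half_lattice_points:
  assumes x: "x \<in> int_points" "(1/2) *\<^sub>R x \<in> S"
  obtains v w where "v \<in> C" "w \<in> C" "x = v + w"
proof -
  obtain t where t: "\<And>v. v \<in> C \<Longrightarrow> 0 \<le> t v" "sum t C = 1" "(\<Sum>v\<in>C. t v *\<^sub>R v) = (1/2) *\<^sub>R x"
    using x(2) unfolding S_eq convex_hull_finite[OF finite_C] by auto
  have "C \<noteq> {}" using t(2) by auto
  then obtain c where c: "c \<in> C" by auto
  have "x = 2 *\<^sub>R (1/2) *\<^sub>R x" by simp
  \<comment> \<open>The doubled convex coordinates of \<open>x\<close> have total weight 2, whereas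
    \<open>generates\<close> supplies weight 1. Subtracting a vertex \<open>c\<close> makes the two
    comparable and shows that the doubled coordinates are integral.\<close>
  then have "x - c \<in> A \<inter> int_points"
    using x c C_lattice S_subset_A subspace_A
    by (metis Int_iff int_points_diff subsetD subspace_diff subspace_scale)
  then obtain u where u: "\<And>v. v \<in> C \<Longrightarrow> u v \<in> \<int>" "sum u C = 1" "(\<Sum>v\<in>C. u v *\<^sub>R v) = x - c"
    using generates by metis
  let ?\<delta> = "\<lambda>z. if z = c then 1 else 0 :: real"
  have eq: "2 * t v - ?\<delta> v = u v" if "v \<in> C" for v
  proof (rule affine_independent_unique[OF finite_C indep_C _ _ that])
    show "(\<Sum>v\<in>C. 2 * t v - ?\<delta> v) = sum u C"
      using t(2) u(2) c finite_C by (simp add: sum_subtractf flip: sum_distrib_left)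
    have "(\<Sum>v\<in>C. (2 * t v - ?\<delta> v) *\<^sub>R v) = 2 *\<^sub>R (\<Sum>v\<in>C. t v *\<^sub>R v) - (\<Sum>v\<in>C. if v = c then v else 0)"
      by (auto simp: scaleR_diff_left sum_subtractf scaleR_sum_right intro!: sum.cong arg_cong2[of _ _ _ _ "(-)"])
    then show "(\<Sum>v\<in>C. (2 * t v - ?\<delta> v) *\<^sub>R v) = (\<Sum>v\<in>C. u v *\<^sub>R v)"
      using t(3) u(3) c finite_C by simp
  qed
  have "2 * t v \<in> \<int>" if "v \<in> C" for v
    using u(1)[OF that] eq[OF that] by (smt (verit) Ints_add Ints_1)
  moreover have "(\<Sum>v\<in>C. 2 * t v) = 2" using t(2) by (simp flip: sum_distrib_left)
  ultimately obtain v w where vw: "v \<in> C" "w \<in> C"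
      "\<And>z. z \<in> C \<Longrightarrow> 2 * t z = (if z = v then 1 else 0) + (if z = w then 1 else 0)"
    using Ints_nonneg_sum_2[of C "\<lambda>v. 2 * t v"] finite_C t(1) by auto
  have "x = (\<Sum>z\<in>C. (2 * t z) *\<^sub>R z)"
    using arg_cong[OF t(3), of "(*\<^sub>R) 2"] by (simp add: scaleR_sum_right)
  also have "\<dots> = (\<Sum>z\<in>C. (if z = v then z else 0) + (if z = w then z else 0))"
    by (intro sum.cong) (auto simp: vw(3) scaleR_add_left)
  also have "\<dots> = v + w" using vw finite_C by (simp add: sum.distrib)
  finally show ?thesis using that vw by blast
qed

end

subsection \<open>Counting the edges of a unimodular triangulation\<close>

text \<open>Sending the edge with endpoints \<open>v\<close> and \<open>w\<close> to
  \<open>v + w\<close>, twice its midpoint, is a bijection onto the sums of two lattice points that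
  are not twice a lattice point.\<close>

lemma card_triangulation_edges:
  assumes T: "unimodular_triangulation P T" and P: "convex P" "0 \<in> P"
  defines "L \<equiv> P \<inter> int_points"
  shows "card (triangulation_edges T) = card ({v + w | v w. v \<in> L \<and> w \<in> L} - (\<lambda>v. v + v) ` L)"
proof -
  let ?A = "affine hull P"
  define C where "C S = S \<inter> int_points" for S :: "('a \<Rightarrow>\<^sub>0 real) set"
  have UT: "\<Union>T = P" using T by (simp add: unimodular_triangulation_def lattice_triangulation_def)
  have face: "S \<inter> S' face_of S" if "S \<in> T" "S' \<in> T" for S S'
    using T that by (simp add: unimodular_triangulation_def lattice_triangulation_def)
  have A: "subspace ?A"
    using P by (simp add: subspace_affine hull_inc)
  have simplex: "unimodular_simplex ?A S (C S)" if S: "S \<in> T" for S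
  proof -
    obtain d where d: "lattice_equivalent ?A S (coord_space d) (standard_simplex d)"
      using T S by (auto simp: unimodular_triangulation_def)
    have "S \<subseteq> ?A" using S UT hull_subset[of P affine] by blast
    from affine_affine_hull this d obtain D where "finite D" "D \<subseteq> ?A \<inter> int_points"
        "\<not> affine_dependent D" "S = convex hull D"
        "\<And>x. x \<in> ?A \<inter> int_points \<Longrightarrow> \<exists>u. (\<forall>v\<in>D. u v \<in> \<int>) \<and> sum u D = 1 \<and> (\<Sum>v\<in>D. u v *\<^sub>R v) = x"
      by (rule unimodular_simplexE) blast
    with A have "unimodular_simplex ?A S D" by unfold_locales
    moreover from this have "D = C S" by (simp add: unimodular_simplex.lattice_points C_def)
    ultimately show ?thesis by simp
  qed
  have finC: "finite (C S)" and indC: "\<not> affine_dependent (C S)" and SC: "S = convex hull C S" if "S \<in> T" for S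
    using simplex[OF that] by (simp_all add: unimodular_simplex_def)
  have CL: "v \<in> L \<longleftrightarrow> (\<exists>S\<in>T. v \<in> C S)" for v
    using UT by (auto simp: L_def C_def)
  \<comment> \<open>The common midpoint lies in both simplices. As their intersection is a face of
    \<open>S\<close>, the points \<open>v\<close> and \<open>w\<close> also lie in
    \<open>S'\<close>, and uniqueness within the single simplex \<open>S'\<close> applies.\<close>
  have unique: "{v, w} = {v', w'}"
    if S: "S \<in> T" "S' \<in> T" and vw: "v \<in> C S" "w \<in> C S" "v' \<in> C S'" "w' \<in> C S'" "v + w = v' + w'"
    for S S' v w v' w'
  proof -
    have conv: "convex S" "convex S'"
      using S SC by (metis convex_convex_hull)+
    have mid: "(1/2) *\<^sub>R (v + w) \<in> S" "(1/2) *\<^sub>R (v + w) \<in> S'"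
      using convexD[OF conv(1), of v w "1/2" "1/2"] convexD[OF conv(2), of v' w' "1/2" "1/2"] vw
      by (auto simp: C_def simp flip: scaleR_add_right)
    have "v \<in> S' \<and> w \<in> S'"
    proof (cases "v = w")
      case True
      then show ?thesis using mid(2) by (simp flip: scaleR_2)
    next
      case False
      then have "(1/2) *\<^sub>R (v + w) \<in> open_segment v w"
        by (auto simp: in_segment scaleR_add_right intro!: exI[of _ "1/2"])
      then show ?thesis
        using face_ofD[OF face[OF S], of "(1/2) *\<^sub>R (v + w)" v w] mid vw by (auto simp: C_def)
    qed
    then have "v \<in> C S'" "w \<in> C S'" using vw by (auto simp: C_def)
    then show ?thesis
      using affine_independent_sum_pair[OF finC[OF S(2)] indC[OF S(2)], of v w v' w'] vw by simp
  qed
  \<comment> \<open>The bijection as a relation: \<open>edges\<close> and \<open>sums\<close>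
    identify its domain and range, \<open>R1\<close> and \<open>R2\<close> show that each side
    determines the other.\<close>
  define R where "R F x \<longleftrightarrow> (\<exists>S\<in>T. \<exists>v\<in>C S. \<exists>w\<in>C S. v \<noteq> w \<and> F = convex hull {v, w} \<and> x = v + w)" for F x
  have edges: "F \<in> triangulation_edges T \<longleftrightarrow> (\<exists>x. R F x)" for F
  proof -
    have "F \<in> triangulation_edges T \<longleftrightarrow> (\<exists>S\<in>T. F face_of S \<and> has_affine_dim F 1)"
      by (simp add: triangulation_edges_def)
    also have "\<dots> \<longleftrightarrow> (\<exists>S\<in>T. \<exists>v\<in>C S. \<exists>w\<in>C S. v \<noteq> w \<and> F = convex hull {v, w})"
    proof (rule bex_cong[OF refl])
      fix S assume S: "S \<in> T"
      show "F face_of S \<and> has_affine_dim F 1 \<longleftrightarrow> (\<exists>v\<in>C S. \<exists>w\<in>C S. v \<noteq> w \<and> F = convex hull {v, w})"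
        using affine_independent_edge_iff[OF finC[OF S] indC[OF S], of F]
        by (simp only: SC[OF S, symmetric])
    qed
    also have "\<dots> \<longleftrightarrow> (\<exists>x. R F x)" unfolding R_def by blast
    finally show ?thesis .
  qed
  have sums: "x \<in> {v + w | v w. v \<in> L \<and> w \<in> L} - (\<lambda>v. v + v) ` L \<longleftrightarrow> (\<exists>F. R F x)" for x
  proof
    assume x: "x \<in> {v + w | v w. v \<in> L \<and> w \<in> L} - (\<lambda>v. v + v) ` L"
    then obtain v w where vw: "v \<in> L" "w \<in> L" "x = v + w" by blast
    have "(1/2) *\<^sub>R x \<in> P" using convexD[OF P(1), of v w "1/2" "1/2"] vw by (simp add: L_def scaleR_add_right)
    then obtain S where S: "S \<in> T" "(1/2) *\<^sub>R x \<in> S" using UT by auto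
    have "x \<in> int_points" using vw by (simp add: L_def int_points_add)
    then obtain v' w' where vw': "v' \<in> C S" "w' \<in> C S" "x = v' + w'"
      using unimodular_simplex.half_lattice_points[OF simplex[OF S(1)] _ S(2)] by blast
    moreover have "v' \<noteq> w'" using x vw' CL S(1) by auto
    ultimately show "\<exists>F. R F x" using S(1) unfolding R_def by blast
  next
    assume "\<exists>F. R F x"
    then obtain S v w where S: "S \<in> T" "v \<in> C S" "w \<in> C S" "v \<noteq> w" "x = v + w"
      by (auto simp: R_def)
    moreover have "x \<noteq> u + u" if "u \<in> L" for u
      using unique[OF S(1) _ S(2,3)] S(4,5) that CL by (metis doubleton_eq_iff)
    ultimately show "x \<in> {v + w | v w. v \<in> L \<and> w \<in> L} - (\<lambda>v. v + v) ` L"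
      using CL by blast
  qed
  have R1: "F = F'" if "R F x" "R F' x" for F F' x
    using that unique unfolding R_def by metis
  have R2: "x = x'" if xx': "R F x" "R F x'" for F x x'
  proof -
    obtain S v w where S: "S \<in> T" "v \<in> C S" "w \<in> C S" "v \<noteq> w" "F = convex hull {v, w}" "x = v + w"
      using xx'(1) by (auto simp: R_def)
    obtain S' v' w' where S': "S' \<in> T" "v' \<in> C S'" "w' \<in> C S'" "v' \<noteq> w'" "F = convex hull {v', w'}" "x' = v' + w'"
      using xx'(2) by (auto simp: R_def)
    have "F \<subseteq> S" using S SC[OF S(1)] by (metis hull_mono insert_subset empty_subsetI)
    \<comment> \<open>The segment \<open>F\<close> contains no lattice points besides
      \<open>v\<close> and \<open>w\<close>: such a point would be a vertex of \<open>S\<close> in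
      the affine hull of two other vertices. Hence \<open>F\<close> determines its
      endpoints.\<close>
    have *: "y \<in> {v, w}" if y: "y \<in> F" "y \<in> C S'" for y
    proof (rule ccontr)
      assume "y \<notin> {v, w}"
      then have "{v, w} \<subseteq> C S - {y}" using S by auto
      moreover have "y \<in> affine hull {v, w}"
        using y S convex_hull_subset_affine_hull by blast
      ultimately have "y \<in> affine hull (C S - {y})" by (meson hull_mono subsetD)
      moreover have "y \<in> C S" using y \<open>F \<subseteq> S\<close> by (auto simp: C_def)
      ultimately show False using indC[OF S(1)] by (auto simp: affine_dependent_def)
    qed
    have "v' \<in> F" "w' \<in> F" using S' by (auto simp: hull_inc)
    with * S' have "v' \<in> {v, w}" "w' \<in> {v, w}" by auto
    then show ?thesis using S(6) S'(4,6) by (auto simp: add.commute)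
  qed
  let ?M = "{v + w | v w. v \<in> L \<and> w \<in> L} - (\<lambda>v. v + v) ` L"
  define \<psi> where "\<psi> x = (SOME F. R F x)" for x
  have \<psi>: "R (\<psi> x) x" if "x \<in> ?M" for x
    using that unfolding sums \<psi>_def by (rule someI_ex)
  have "triangulation_edges T = \<psi> ` ?M"
  proof (rule set_eqI)
    fix F
    show "F \<in> triangulation_edges T \<longleftrightarrow> F \<in> \<psi> ` ?M"
      using edges sums \<psi> R1 by (metis (no_types, lifting) image_iff)
  qed
  moreover have "inj_on \<psi> ?M"
    using \<psi> R2 by (metis (no_types, lifting) inj_onI)
  ultimately show ?thesis by (simp only: card_image)
qed

subsection \<open>Lattice points of symmetric edge polytopes\<close>

definition arc_vectors :: "'v set set \<Rightarrow> ('v \<Rightarrow>\<^sub>0 real) set"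
  where "arc_vectors E = {unit_vec i - unit_vec j | i j. {i, j} \<in> E}"

definition lattice_sums :: "('v \<Rightarrow>\<^sub>0 real) set \<Rightarrow> ('v \<Rightarrow>\<^sub>0 real) set"
  where "lattice_sums L = {v + w | v w. v \<in> L \<and> w \<in> L} - (\<lambda>v. v + v) ` L"

text \<open>The number of edges as an explicit function of the arc set. For \<open>E = {}\<close>
  the only sum is \<open>0 + 0\<close>, which is removed, so the value is 0 as it must be.\<close>

definition sum_count :: "'v set set \<Rightarrow> nat"
  where "sum_count E = card (lattice_sums (insert 0 (arc_vectors E)))"

lemma arc_vectorI: "{i, j} \<in> E \<Longrightarrow> unit_vec i - unit_vec j \<in> arc_vectors E"
  by (auto simp: arc_vectors_def)

lemma complete_arcs_endpoints: "E \<subseteq> complete_arcs n \<Longrightarrow> {i, j} \<in> E \<Longrightarrow> i \<noteq> j \<and> i \<in> {1..n} \<and> j \<in> {1..n}"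
  by (auto simp: complete_arcs_def)

lemma lookup_arc_vector:
  "Poly_Mapping.lookup (unit_vec i - unit_vec j) k = (if i = k then 1 else 0) - (if j = k then 1 else 0)"
  by (simp add: lookup_minus lookup_unit_vec)

text \<open>All inequalities valid on the polytope are obtained from this lemma, by evaluating a
  linear functional on the generators.\<close>

lemma polytope_linear_le:
  assumes "x \<in> sym_edge_polytope E" "linear \<phi>" "\<And>i j. {i, j} \<in> E \<Longrightarrow> \<phi> (unit_vec i - unit_vec j) \<le> (b::real)"
  shows "\<phi> x \<le> b"
proof -
  have "convex {y. \<phi> y \<le> b}"
    using convex_linear_vimage[OF assms(2), of "{..b}"] by (simp add: vimage_def)
  then have "convex hull arc_vectors E \<subseteq> {y. \<phi> y \<le> b}"
    using assms(3) by (intro hull_minimal) (auto simp: arc_vectors_def)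
  then show ?thesis using assms(1) by (auto simp: sym_edge_polytope_def arc_vectors_def)
qed

lemma linear_lookup: "linear (\<lambda>x :: 'v \<Rightarrow>\<^sub>0 real. Poly_Mapping.lookup x i)"
  by (rule linearI) (simp_all add: lookup_add)

lemma linear_lookup_sum:
  "linear (\<lambda>x :: 'v \<Rightarrow>\<^sub>0 real. \<Sum>i\<in>I. Poly_Mapping.lookup x i)"
  "linear (\<lambda>x :: 'v \<Rightarrow>\<^sub>0 real. - (\<Sum>i\<in>I. Poly_Mapping.lookup x i))"
  by (rule linearI; simp add: lookup_add sum.distrib sum_distrib_left)+

text \<open>On the polytope every finite sum of coordinates lies between -1 and 1, and the total is
  0. A nonzero lattice point therefore has exactly one entry 1 and one entry -1, and a linear
  functional shows that their positions form an arc.\<close>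

lemma int_points_sym_edge_polytope:
  assumes E: "E \<subseteq> complete_arcs n" "E \<noteq> {}"
  shows "sym_edge_polytope E \<inter> int_points = insert 0 (arc_vectors E)"
proof
  let ?P = "sym_edge_polytope E"
  have arcP: "arc_vectors E \<subseteq> ?P"
    unfolding sym_edge_polytope_def arc_vectors_def by (rule hull_subset)
  obtain i j where ij: "{i, j} \<in> E" using E unfolding complete_arcs_def card_2_iff by blast
  then have "unit_vec i - unit_vec j \<in> ?P" "unit_vec j - unit_vec i \<in> ?P"
    using arcP arc_vectorI[OF ij] arc_vectorI[of j i E] by (auto simp: insert_commute)
  then have "0 \<in> ?P"
    using convexD[of ?P "unit_vec i - unit_vec j" "unit_vec j - unit_vec i" "1/2" "1/2"]
    by (simp add: sym_edge_polytope_def algebra_simps)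
  then show "insert 0 (arc_vectors E) \<subseteq> ?P \<inter> int_points"
    using arcP by (auto simp: arc_vectors_def int_points_diff)
  show "?P \<inter> int_points \<subseteq> insert 0 (arc_vectors E)"
  proof
    fix x assume x: "x \<in> ?P \<inter> int_points"
    let ?x = "Poly_Mapping.lookup x"
    have sum_le: "sum ?x I \<le> 1" and sum_ge: "- 1 \<le> sum ?x I" if "finite I" for I
    proof -
      have *: "(\<Sum>k\<in>I. Poly_Mapping.lookup (unit_vec i - unit_vec j) k) = (if i \<in> I then 1 else 0) - (if j \<in> I then 1 else 0)" for i j
        using that by (simp add: lookup_arc_vector sum_subtractf)
      show "sum ?x I \<le> 1"
        by (rule polytope_linear_le[OF _ linear_lookup_sum(1)]) (use x * in auto)
      show "- 1 \<le> sum ?x I"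
        using polytope_linear_le[OF _ linear_lookup_sum(2)[of I], of x E 1] x * by simp
    qed
    have supp: "?x k = 0" if "k \<notin> {1..n}" for k
    proof -
      have z: "Poly_Mapping.lookup (unit_vec i - unit_vec j) k = 0" if "{i, j} \<in> E" for i j
        using complete_arcs_endpoints[OF E(1) that] \<open>k \<notin> _\<close> by (auto simp: lookup_arc_vector)
      show ?thesis
        using polytope_linear_le[OF _ linear_lookup[of k], of x E 0]
          polytope_linear_le[OF _ linear_compose_neg[OF linear_lookup[of k]], of x E 0] x z by simp
    qed
    have total: "sum ?x {1..n} = 0"
    proof -
      have z: "(\<Sum>k\<in>{1..n}. Poly_Mapping.lookup (unit_vec i - unit_vec j) k) = 0" if "{i, j} \<in> E" for i j
        using complete_arcs_endpoints[OF E(1) that] by (simp add: lookup_arc_vector sum_subtractf)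
      show ?thesis
        using polytope_linear_le[OF _ linear_lookup_sum(1)[of "{1..n}"], of x E 0]
          polytope_linear_le[OF _ linear_lookup_sum(2)[of "{1..n}"], of x E 0] x z by simp
    qed
    have xint: "?x k \<in> \<int>" for k using x by (simp add: int_points_def)
    show "x \<in> insert 0 (arc_vectors E)"
    proof (cases "x = 0")
      case False
      have pos_ge: "?x k \<ge> 1" if "?x k > 0" for k using xint[of k] that by (auto elim!: Ints_cases)
      have neg_le: "?x k \<le> -1" if "?x k < 0" for k using xint[of k] that by (auto elim!: Ints_cases)
      obtain k where k: "?x k \<noteq> 0" using False by (metis lookup_zero poly_mapping_eqI)
      have kn: "k \<in> {1..n}" using k supp by blast
      have "\<exists>i. ?x i > 0"
      proof (rule ccontr)
        assume "\<nexists>i. ?x i > 0"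
        then have np: "?x i \<le> 0" for i by (meson not_le)
        have "sum ?x {1..n} = ?x k + sum ?x ({1..n} - {k})" using kn by (simp add: sum.remove)
        moreover have "sum ?x ({1..n} - {k}) \<le> 0" by (intro sum_nonpos np)
        ultimately show False using total np[of k] k by linarith
      qed
      then obtain i where i: "?x i > 0" by blast
      have "\<exists>j. ?x j < 0"
      proof (rule ccontr)
        assume "\<nexists>j. ?x j < 0"
        then have np: "?x i \<ge> 0" for i by (meson not_le)
        have "sum ?x {1..n} = ?x k + sum ?x ({1..n} - {k})" using kn by (simp add: sum.remove)
        moreover have "sum ?x ({1..n} - {k}) \<ge> 0" by (intro sum_nonneg np)
        ultimately show False using total np[of k] k by linarith
      qed
      then obtain j where j: "?x j < 0" by blast
      have "?x i = 1" "?x j = -1"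
        using sum_le[of "{i}"] sum_ge[of "{j}"] pos_ge[OF i] neg_le[OF j] by auto
      have "?x k = 0" if "k \<noteq> i" "k \<noteq> j" for k
      proof -
        have "\<not> ?x k > 0" using sum_le[of "{i, k}"] that \<open>?x i = 1\<close> by auto
        moreover have "\<not> ?x k < 0" using sum_ge[of "{j, k}"] that \<open>?x j = -1\<close> by auto
        ultimately show ?thesis by simp
      qed
      then have xij: "x = unit_vec i - unit_vec j"
        using \<open>?x i = 1\<close> \<open>?x j = -1\<close> i j by (intro poly_mapping_eqI) (auto simp: lookup_arc_vector)
      have "{i, j} \<in> E"
      proof (rule ccontr)
        assume "{i, j} \<notin> E"
        \<comment> \<open>On a generator this functional takes the value 2 only at
          \<open>e_i - e_j\<close>, which is no generator if \<open>{i, j}\<close> is not an arc;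
          yet it takes the value 2 at \<open>x\<close>.\<close>
        have "?x i - ?x j \<le> 1"
        proof (rule polytope_linear_le)
          fix k l assume "{k, l} \<in> E"
          then have "k \<noteq> i \<or> l \<noteq> j" using \<open>{i, j} \<notin> E\<close> by auto
          then show "Poly_Mapping.lookup (unit_vec k - unit_vec l) i - Poly_Mapping.lookup (unit_vec k - unit_vec l) j \<le> (1::real)"
            by (auto simp: lookup_arc_vector)
        qed (use x in \<open>auto intro!: linear_compose_sub linear_lookup\<close>)
        then show False using \<open>?x i = 1\<close> \<open>?x j = -1\<close> by simp
      qed
      then show ?thesis using xij by (auto simp: arc_vectors_def)
    qed simp
  qed
qed

lemma triangulation_edges_sym_edge_polytope:
  assumes E: "E \<subseteq> complete_arcs n" and T: "unimodular_triangulation (sym_edge_polytope E) T"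
  shows "card (triangulation_edges T) = sum_count E"
proof (cases "E = {}")
  case True
  \<comment> \<open>The polytope is empty, hence so is its affine hull, which cannot be in bijection
    with a coordinate space, as that contains \<open>0\<close>.\<close>
  have "T = {}"
  proof (rule ccontr)
    assume "T \<noteq> {}"
    then obtain S where "S \<in> T" by blast
    then have "\<exists>d. lattice_equivalent ({} :: (nat \<Rightarrow>\<^sub>0 real) set) S (coord_space d) (standard_simplex d)"
      using T True by (auto simp: unimodular_triangulation_def sym_edge_polytope_def)
    then obtain d :: nat and f where "bij_betw f ({} :: (nat \<Rightarrow>\<^sub>0 real) set) (coord_space d)"
      by (auto simp: lattice_equivalent_def)
    moreover have "0 \<in> coord_space d" using subspace_coord_space by (rule subspace_0)
    ultimately show False by (auto simp: bij_betw_def)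
  qed
  with True show ?thesis
    by (simp add: triangulation_edges_def sum_count_def lattice_sums_def arc_vectors_def)
next
  case False
  have "0 \<in> sym_edge_polytope E" using int_points_sym_edge_polytope[OF E False] by blast
  moreover have "convex (sym_edge_polytope E)" by (simp add: sym_edge_polytope_def)
  ultimately show ?thesis
    using card_triangulation_edges[OF T] int_points_sym_edge_polytope[OF E False]
    by (simp add: sum_count_def lattice_sums_def)
qed

subsection \<open>Inserting an arc\<close>

lemma finite_arc_vectors:
  fixes E :: "nat set set"
  assumes "E \<subseteq> complete_arcs n" shows "finite (arc_vectors E)"
proof -
  have "arc_vectors E \<subseteq> (\<lambda>(i, j). unit_vec i - unit_vec j) ` ({1..n} \<times> {1..n})"
    using complete_arcs_endpoints[OF assms] by (fastforce simp: arc_vectors_def)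
  then show ?thesis by (rule finite_subset) simp
qed

lemma finite_lattice_sums: "finite L \<Longrightarrow> finite (lattice_sums L)"
  by (rule finite_subset[of _ "(\<lambda>(v, w). v + w) ` (L \<times> L)"]) (auto simp: lattice_sums_def)

lemma arc_vectors_values:
  assumes "y \<in> insert 0 (arc_vectors E)"
  shows "Poly_Mapping.lookup y k \<in> {-1, 0, 1}"
proof -
  have "Poly_Mapping.lookup (unit_vec i - unit_vec j) k \<in> {-1, 0, 1 :: real}" for i j
    unfolding lookup_arc_vector by (cases "i = k"; cases "j = k"; simp)
  then show ?thesis using assms unfolding arc_vectors_def by auto
qed

lemma arc_vectors_bounds:
  assumes "y \<in> insert 0 (arc_vectors E)"
  shows "Poly_Mapping.lookup y k \<le> 1" "Poly_Mapping.lookup y k \<ge> -1"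
  using assms by (auto simp: arc_vectors_def lookup_arc_vector)

lemma arc_vector_unique:
  assumes "y \<in> insert 0 (arc_vectors E)" "Poly_Mapping.lookup y a = 1" "Poly_Mapping.lookup y b = -1"
  shows "y = unit_vec a - unit_vec b" "{a, b} \<in> E"
  using assms by (auto simp: arc_vectors_def lookup_arc_vector split: if_splits)

text \<open>New arcs also bring new doubled vectors, which might remove old sums. But entries are
  bounded by 1 in absolute value, so \<open>2(e_a - e_b)\<close> arises only as
  \<open>e_a - e_b\<close> taken twice; were it an old sum, \<open>{a, b}\<close> would be an old
  arc.\<close>

lemma lattice_sums_mono:
  assumes "E \<subseteq> E'" "E' \<subseteq> complete_arcs n"
  shows "lattice_sums (insert 0 (arc_vectors E)) \<subseteq> lattice_sums (insert 0 (arc_vectors E'))"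
proof
  let ?L = "insert 0 (arc_vectors E)" and ?L' = "insert 0 (arc_vectors E')"
  have LL: "?L \<subseteq> ?L'" using assms by (auto simp: arc_vectors_def)
  fix x assume x: "x \<in> lattice_sums ?L"
  have "x \<noteq> y + y" if y: "y \<in> ?L'" for y
  proof
    assume xy: "x = y + y"
    then have "y \<notin> ?L" using x by (auto simp: lattice_sums_def)
    with y obtain a b where ab: "y = unit_vec a - unit_vec b" "{a, b} \<in> E'" "{a, b} \<notin> E"
      by (auto simp: arc_vectors_def)
    have "a \<noteq> b" using complete_arcs_endpoints[OF assms(2) ab(2)] by simp
    obtain v w where vw: "v \<in> ?L" "w \<in> ?L" "x = v + w" using x by (auto simp: lattice_sums_def)
    have "Poly_Mapping.lookup x k = 2 * Poly_Mapping.lookup y k" for k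
      using xy by (metis lookup_add mult_2)
    then have "Poly_Mapping.lookup x a = 2" "Poly_Mapping.lookup x b = -2"
      using ab \<open>a \<noteq> b\<close> by (auto simp: lookup_arc_vector)
    then have "Poly_Mapping.lookup v a = 1" "Poly_Mapping.lookup v b = -1"
      using vw(3) arc_vectors_bounds[OF vw(1), of a] arc_vectors_bounds[OF vw(2), of a]
        arc_vectors_bounds[OF vw(1), of b] arc_vectors_bounds[OF vw(2), of b]
      by (auto simp: lookup_add)
    then have "{a, b} \<in> E" using arc_vector_unique(2)[OF vw(1)] by blast
    with ab show False by simp
  qed
  moreover have "\<exists>v\<in>?L'. \<exists>w\<in>?L'. x = v + w" using x LL unfolding lattice_sums_def by blast
  ultimately show "x \<in> lattice_sums ?L'" unfolding lattice_sums_def by blast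
qed

lemma sum_count_insert_ge:
  fixes E :: "nat set set"
  assumes E: "insert e E \<subseteq> complete_arcs n"
    and N: "N \<subseteq> lattice_sums (insert 0 (arc_vectors (insert e E)))"
      "N \<inter> lattice_sums (insert 0 (arc_vectors E)) = {}"
  shows "sum_count E + card N \<le> sum_count (insert e E)"
proof -
  let ?M = "lattice_sums (insert 0 (arc_vectors E))" and ?M' = "lattice_sums (insert 0 (arc_vectors (insert e E)))"
  have fin: "finite ?M'" using finite_arc_vectors[OF E] by (simp add: finite_lattice_sums)
  have sub: "?M \<subseteq> ?M'" using E by (intro lattice_sums_mono) auto
  have "card ?M + card N = card (?M \<union> N)"
    using N fin sub by (subst card_Un_disjoint) (auto intro: finite_subset)
  also have "\<dots> \<le> card ?M'" using N(1) sub fin by (intro card_mono) auto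
  finally show ?thesis by (simp add: sum_count_def)
qed

text \<open>The new sum is \<open>e_a - e_b\<close> plus the origin. All old vectors vanish at the
  isolated node \<open>a\<close>, so it was not a sum before; its entry at \<open>a\<close> is odd,
  so it is not a doubled vector.\<close>

lemma sum_count_insert_isolated:
  fixes E :: "nat set set"
  assumes E: "insert {a, b} E \<subseteq> complete_arcs n" and "{a, b} \<notin> E" and iso: "\<And>j. {a, j} \<notin> E"
  shows "sum_count E + 1 \<le> sum_count (insert {a, b} E)"
proof -
  let ?L = "insert 0 (arc_vectors E)" and ?L' = "insert 0 (arc_vectors (insert {a, b} E))"
  let ?x = "unit_vec a - unit_vec b"
  have ab: "a \<noteq> b" using complete_arcs_endpoints[OF E] by simp
  have "?x \<in> ?L'" by (simp add: arc_vectorI)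
  moreover have "?x \<noteq> y + y" if "y \<in> ?L'" for y
  proof
    assume "?x = y + y"
    then have "Poly_Mapping.lookup ?x a = 2 * Poly_Mapping.lookup y a" by (metis lookup_add mult_2)
    moreover have "Poly_Mapping.lookup y a \<in> {-1, 0, 1}"
      by (rule arc_vectors_values[OF that])
    ultimately show False using ab by (auto simp: lookup_arc_vector)
  qed
  moreover have "?x = ?x + 0" by simp
  ultimately have "?x \<in> lattice_sums ?L'" unfolding lattice_sums_def by blast
  moreover have "?x \<notin> lattice_sums ?L"
  proof
    assume "?x \<in> lattice_sums ?L"
    then obtain v w where vw: "v \<in> ?L" "w \<in> ?L" "?x = v + w" by (auto simp: lattice_sums_def)
    have z: "Poly_Mapping.lookup y a = 0" if "y \<in> ?L" for y
      using that iso by (auto simp: arc_vectors_def lookup_arc_vector) (metis insert_commute)+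
    have "Poly_Mapping.lookup ?x a = 0" using vw z by (simp add: lookup_add)
    then show False using ab by (simp add: lookup_arc_vector)
  qed
  ultimately show ?thesis
    using sum_count_insert_ge[OF E, of "{?x}"] by simp
qed

text \<open>The vector \<open>e_a - e_b + e_k - e_l\<close> has one other splitting into arc
  vectors, \<open>(e_a - e_l) + (e_k - e_b)\<close>, and this one needs the arc
  \<open>{a, l}\<close>, which is absent. The pairs are ordered, so each arc \<open>{k, l}\<close>
  may contribute two new sums.\<close>

lemma sum_count_insert_pairs:
  fixes E :: "nat set set"
  assumes E: "insert {a, b} E \<subseteq> complete_arcs n" and "{a, b} \<notin> E"
  shows "sum_count E + card {(k, l). k \<notin> {a, b} \<and> l \<notin> {a, b} \<and> {k, l} \<in> E \<and> {a, l} \<notin> E}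
           \<le> sum_count (insert {a, b} E)"
proof -
  let ?L = "insert 0 (arc_vectors E)" and ?L' = "insert 0 (arc_vectors (insert {a, b} E))"
  let ?Q = "{(k, l). k \<notin> {a, b} \<and> l \<notin> {a, b} \<and> {k, l} \<in> E \<and> {a, l} \<notin> E}"
  define x where "x = (\<lambda>(k, l). (unit_vec a - unit_vec b) + (unit_vec k - unit_vec l))"
  have ab: "a \<noteq> b" using complete_arcs_endpoints[OF E] by simp
  have kl: "k \<noteq> l" if "{k, l} \<in> E" for k l using complete_arcs_endpoints[OF E] that by blast
  have lookup_x: "Poly_Mapping.lookup (x (k, l)) i =
      (if i = a \<or> i = k then 1 else if i = b \<or> i = l then -1 else 0)" if "(k, l) \<in> ?Q" for k l i
    using that ab kl[of k l] by (auto simp: x_def lookup_add lookup_arc_vector)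
  have "inj_on x ?Q"
  proof (rule inj_onI)
    fix p q assume pq: "p \<in> ?Q" "q \<in> ?Q" "x p = x q"
    obtain k l k' l' where eq: "p = (k, l)" "q = (k', l')" by fastforce
    have *: "Poly_Mapping.lookup (x (k, l)) i = Poly_Mapping.lookup (x (k', l')) i" for i
      using pq eq by simp
    have "k = k'" using *[of k] pq(1,2) kl[of k l] kl[of k' l'] unfolding eq
      by (simp add: lookup_x split: if_splits)
    moreover have "l = l'" using *[of l] pq(1,2) kl[of k l] kl[of k' l'] unfolding eq
      by (simp add: lookup_x split: if_splits)
    ultimately show "p = q" using eq by simp
  qed
  have "x (k, l) \<in> lattice_sums ?L' \<and> x (k, l) \<notin> lattice_sums ?L" if Q: "(k, l) \<in> ?Q" for k l
  proof
    note lx = lookup_x[OF Q]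
    have ne: "a \<noteq> k" "a \<noteq> l" "b \<noteq> k" "b \<noteq> l" "k \<noteq> l" using Q kl[of k l] by auto
    have "unit_vec a - unit_vec b \<in> ?L'" "unit_vec k - unit_vec l \<in> ?L'"
      using Q by (auto intro!: arc_vectorI)
    moreover have "x (k, l) \<noteq> y + y" if "y \<in> ?L'" for y
    proof
      assume "x (k, l) = y + y"
      then have "Poly_Mapping.lookup (x (k, l)) a = 2 * Poly_Mapping.lookup y a" by (metis lookup_add mult_2)
      moreover have "Poly_Mapping.lookup y a \<in> {-1, 0, 1}"
        by (rule arc_vectors_values[OF that])
      ultimately show False by (auto simp: lx)
    qed
    moreover have "x (k, l) = (unit_vec a - unit_vec b) + (unit_vec k - unit_vec l)" by (simp add: x_def)
    ultimately show "x (k, l) \<in> lattice_sums ?L'" unfolding lattice_sums_def by blast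
    show "x (k, l) \<notin> lattice_sums ?L"
    proof
      assume "x (k, l) \<in> lattice_sums ?L"
      then obtain v w where vw: "v \<in> ?L" "w \<in> ?L" "x (k, l) = v + w" by (auto simp: lattice_sums_def)
      have lvw: "Poly_Mapping.lookup v i + Poly_Mapping.lookup w i = Poly_Mapping.lookup (x (k, l)) i" for i
        using vw(3) by (simp add: lookup_add)
      \<comment> \<open>Let \<open>y = e_a - e_c\<close> be the summand with entry 1 at
        \<open>a\<close>. As \<open>c\<close> is neither \<open>b\<close> nor \<open>l\<close>, the
        other summand must compensate with a positive entry at \<open>c\<close> besides the one at
        \<open>k\<close>: either two entries 1, or an entry 2 if \<open>c = k\<close>.\<close>
      have False if y: "y \<in> ?L" "z \<in> ?L" and yz: "\<And>i. Poly_Mapping.lookup y i + Poly_Mapping.lookup z i = Poly_Mapping.lookup (x (k, l)) i"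
          and ya: "Poly_Mapping.lookup y a = 1" for y z
      proof -
        obtain c where c: "y = unit_vec a - unit_vec c" "{a, c} \<in> E"
          using y(1) ya by (auto simp: arc_vectors_def lookup_arc_vector split: if_splits)
        have "a \<noteq> c" using complete_arcs_endpoints[OF E] c(2) by blast
        have "c \<noteq> b" "c \<noteq> l" using c(2) assms(2) Q by auto
        have z: "Poly_Mapping.lookup z i = Poly_Mapping.lookup (x (k, l)) i - Poly_Mapping.lookup y i" for i
          using yz[of i] by simp
        have "Poly_Mapping.lookup z c \<ge> 1"
          using \<open>a \<noteq> c\<close> \<open>c \<noteq> b\<close> \<open>c \<noteq> l\<close> by (simp add: z lx c(1) lookup_arc_vector)
        moreover from this have "c \<noteq> k"
          using arc_vectors_bounds(1)[OF y(2), of c] ne \<open>a \<noteq> c\<close> by (auto simp: z lx c(1) lookup_arc_vector)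
        then have "Poly_Mapping.lookup z k \<ge> 1"
          using ne by (simp add: z lx c(1) lookup_arc_vector)
        ultimately show False
          using y(2) \<open>c \<noteq> k\<close> by (auto simp: arc_vectors_def lookup_arc_vector split: if_splits)
      qed
      note contra = this
      have "Poly_Mapping.lookup v a \<in> {-1, 0, 1}" "Poly_Mapping.lookup w a \<in> {-1, 0, 1}"
        by (rule arc_vectors_values[OF vw(1)], rule arc_vectors_values[OF vw(2)])
      moreover have "Poly_Mapping.lookup v a + Poly_Mapping.lookup w a = 1"
        unfolding lvw by (simp add: lx)
      ultimately have "Poly_Mapping.lookup v a = 1 \<or> Poly_Mapping.lookup w a = 1" by auto
      then show False
        using contra[OF vw(1,2) lvw] contra[OF vw(2,1)] lvw by (auto simp: add.commute)
    qed
  qed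
  then have "x ` ?Q \<subseteq> lattice_sums ?L'" "x ` ?Q \<inter> lattice_sums ?L = {}" by auto
  from sum_count_insert_ge[OF E this] show ?thesis
    using \<open>inj_on x ?Q\<close> by (simp add: card_image)
qed

subsection \<open>Variance of functions of a random subset\<close>

text \<open>The ground set is arbitrary because conditioning on one element \<open>e\<close> leaves
  a random subset of \<open>I - {e}\<close>.\<close>

definition random_subset :: "'a set \<Rightarrow> real \<Rightarrow> 'a set pmf"
  where "random_subset I q =
    map_pmf (\<lambda>\<omega>. {e \<in> I. \<omega> e}) (Pi_pmf I False (\<lambda>_. bernoulli_pmf q))"

lemma set_random_subset: "set_pmf (random_subset I q) \<subseteq> Pow I"
  by (auto simp: random_subset_def)

lemma integrable_random_subset [simp]:
  fixes G :: "'a set \<Rightarrow> real"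
  shows "finite I \<Longrightarrow> integrable (measure_pmf (random_subset I q)) G"
  by (rule integrable_measure_pmf_finite, rule finite_subset[OF set_random_subset]) simp

lemma expectation_random_subset_mono:
  fixes G H :: "'a set \<Rightarrow> real"
  assumes "finite I" "\<And>S. S \<subseteq> I \<Longrightarrow> G S \<le> H S"
  shows "measure_pmf.expectation (random_subset I q) G \<le> measure_pmf.expectation (random_subset I q) H"
  using assms set_random_subset[of I q] by (intro integral_mono_AE) (auto simp: AE_measure_pmf_iff)

lemma expectation_random_subset_cong:
  fixes G H :: "'a set \<Rightarrow> real"
  assumes "\<And>S. S \<subseteq> I \<Longrightarrow> G S = H S"
  shows "measure_pmf.expectation (random_subset I q) G = measure_pmf.expectation (random_subset I q) H"
  using assms set_random_subset[of I q] by (intro integral_cong_AE) (auto simp: AE_measure_pmf_iff)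

lemma random_subset_insert:
  assumes "finite J" "e \<notin> J"
  shows "random_subset (insert e J) q =
    bernoulli_pmf q \<bind> (\<lambda>y. map_pmf (\<lambda>S. if y then insert e S else S) (random_subset J q))"
proof -
  have *: "{x \<in> insert e J. (f(e := y)) x} = (if y then insert e {x \<in> J. f x} else {x \<in> J. f x})" for f y
    using assms(2) by auto
  then show ?thesis
    unfolding random_subset_def Pi_pmf_insert'[OF assms]
    by (simp add: map_pmf_def bind_assoc_pmf bind_return_pmf * del: fun_upd_apply)
qed

lemma expectation_random_subset_insert:
  fixes G :: "'a set \<Rightarrow> real"
  assumes "finite J" "e \<notin> J" "0 \<le> q" "q \<le> 1"
  shows "measure_pmf.expectation (random_subset (insert e J) q) G =
    q * measure_pmf.expectation (random_subset J q) (\<lambda>S. G (insert e S)) +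
    (1 - q) * measure_pmf.expectation (random_subset J q) G"
proof -
  have fin: "finite (set_pmf (random_subset J q))"
    using assms(1) by (intro finite_subset[OF set_random_subset]) simp
  have "measure_pmf.expectation (random_subset (insert e J) q) G =
    (\<Sum>y\<in>UNIV. pmf (bernoulli_pmf q) y *\<^sub>R
       measure_pmf.expectation (map_pmf (\<lambda>S. if y then insert e S else S) (random_subset J q)) G)"
    unfolding random_subset_insert[OF assms(1,2)] by (rule pmf_expectation_bind) (use fin in auto)
  then show ?thesis using assms(3,4) by (simp add: UNIV_bool)
qed

text \<open>Conditioning on \<open>e\<close>, written with the same distribution on both sides:
  neither \<open>insert e S\<close> nor \<open>S - {e}\<close> depends on whether \<open>e\<close>
  was chosen.\<close>

lemma expectation_random_subset_split:
  fixes G :: "'a set \<Rightarrow> real"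
  assumes "finite I" "e \<in> I" "0 \<le> q" "q \<le> 1"
  shows "measure_pmf.expectation (random_subset I q) G =
    q * measure_pmf.expectation (random_subset I q) (\<lambda>S. G (insert e S)) +
    (1 - q) * measure_pmf.expectation (random_subset I q) (\<lambda>S. G (S - {e}))"
proof -
  define J where "J = I - {e}"
  have I: "I = insert e J" "finite J" "e \<notin> J" using assms by (auto simp: J_def)
  have "measure_pmf.expectation (random_subset J q) (\<lambda>S. G (S - {e})) = measure_pmf.expectation (random_subset J q) G"
    by (rule expectation_random_subset_cong) (use I(3) in \<open>auto intro!: arg_cong[of _ _ G]\<close>)
  moreover have "measure_pmf.expectation (random_subset J q) (\<lambda>S. G (insert e S - {e})) = measure_pmf.expectation (random_subset J q) G"
    by (rule expectation_random_subset_cong) (use I(3) in \<open>auto intro!: arg_cong[of _ _ G]\<close>)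
  ultimately show ?thesis
    unfolding I(1) using assms(3,4) by (simp add: expectation_random_subset_insert[OF I(2,3)] algebra_simps)
qed

text \<open>A discrete integration by parts: the centred indicator is \<open>1 - q\<close> with
  probability \<open>q\<close> and \<open>-q\<close> otherwise, independently of the other
  elements.\<close>

lemma covariance_indicator:
  fixes H :: "'a set \<Rightarrow> real"
  assumes "finite I" "e \<in> I" "0 \<le> q" "q \<le> 1"
  shows "measure_pmf.expectation (random_subset I q) (\<lambda>S. (of_bool (e \<in> S) - q) * H S) =
    q * (1 - q) * measure_pmf.expectation (random_subset I q) (\<lambda>S. H (insert e S) - H (S - {e}))"
  using assms(1) by (subst expectation_random_subset_split[OF assms]) (simp add: algebra_simps)

lemma variance_random_subset_ge:
  fixes G :: "'a set \<Rightarrow> real"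
  assumes I: "finite I" and q: "0 \<le> q" "q \<le> 1" and "0 \<le> \<delta>"
    and D: "\<And>e. e \<in> I \<Longrightarrow> \<delta> \<le> measure_pmf.expectation (random_subset I q) (\<lambda>S. G (insert e S) - G (S - {e}))"
  shows "real (card I) * q * (1 - q) * \<delta>\<^sup>2 \<le> measure_pmf.variance (random_subset I q) G"
proof -
  let ?E = "measure_pmf.expectation (random_subset I q)"
  define H where "H S = G S - ?E G" for S
  define Y where "Y S = (\<Sum>e\<in>I. of_bool (e \<in> S) - q)" for S :: "'a set"
  \<comment> \<open>Used twice: \<open>F = Y\<close>, whose increments are all 1, gives the variance
    of \<open>Y\<close>; \<open>F = H\<close> bounds the covariance of \<open>Y\<close> and
    \<open>G\<close> from below.\<close>
  have YF: "?E (\<lambda>S. Y S * F S) = q * (1 - q) * (\<Sum>e\<in>I. ?E (\<lambda>S. F (insert e S) - F (S - {e})))" for F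
  proof -
    have "?E (\<lambda>S. Y S * F S) = (\<Sum>e\<in>I. ?E (\<lambda>S. (of_bool (e \<in> S) - q) * F S))"
      unfolding Y_def sum_distrib_right using I by (subst Bochner_Integration.integral_sum) auto
    then show ?thesis
      using covariance_indicator[OF I _ q] by (simp add: sum_distrib_left)
  qed
  have DY: "Y (insert e S) - Y (S - {e}) = 1" if e: "e \<in> I" for e S
  proof -
    have "Y T = of_bool (e \<in> T) - q + (\<Sum>f\<in>I - {e}. of_bool (f \<in> T) - q)" for T
      unfolding Y_def using I e by (simp add: sum.remove)
    moreover have "(\<Sum>f\<in>I - {e}. of_bool (f \<in> insert e S) - q) = (\<Sum>f\<in>I - {e}. of_bool (f \<in> S - {e}) - q)"
      by (intro sum.cong) auto
    ultimately show ?thesis by simp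
  qed
  have YY: "?E (\<lambda>S. Y S * Y S) = q * (1 - q) * real (card I)"
    unfolding YF by (simp add: DY)
  have "(\<Sum>e\<in>I. \<delta>) \<le> (\<Sum>e\<in>I. ?E (\<lambda>S. H (insert e S) - H (S - {e})))"
    using D by (intro sum_mono) (simp add: H_def)
  then have YH: "q * (1 - q) * (real (card I) * \<delta>) \<le> ?E (\<lambda>S. Y S * H S)"
    unfolding YF using q by (intro mult_left_mono) auto
  have "0 \<le> ?E (\<lambda>S. (H S - \<delta> * Y S)\<^sup>2)" by simp
  also have "\<dots> = ?E (\<lambda>S. (H S)\<^sup>2 - 2 * \<delta> * (Y S * H S) + \<delta>\<^sup>2 * (Y S * Y S))"
    by (simp add: power2_eq_square algebra_simps)
  also have "\<dots> = ?E (\<lambda>S. (H S)\<^sup>2) - 2 * \<delta> * ?E (\<lambda>S. Y S * H S) + \<delta>\<^sup>2 * ?E (\<lambda>S. Y S * Y S)"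
    using I by simp
  finally have "2 * \<delta> * ?E (\<lambda>S. Y S * H S) - \<delta>\<^sup>2 * (q * (1 - q) * real (card I)) \<le> ?E (\<lambda>S. (H S)\<^sup>2)"
    by (simp add: YY)
  moreover have "2 * \<delta> * (q * (1 - q) * (real (card I) * \<delta>)) \<le> 2 * \<delta> * ?E (\<lambda>S. Y S * H S)"
    using YH \<open>0 \<le> \<delta>\<close> by (intro mult_left_mono) auto
  ultimately show ?thesis
    by (simp add: H_def power2_eq_square algebra_simps)
qed

lemma expectation_member:
  assumes "finite I" "e \<in> I" "0 \<le> q" "q \<le> 1"
  shows "measure_pmf.expectation (random_subset I q) (\<lambda>S. of_bool (e \<in> S)) = q"
  by (subst expectation_random_subset_split[OF assms]) simp

lemma expectation_member_nonmember:
  assumes "finite I" "e \<in> I" "f \<in> I" "e \<noteq> f" "0 \<le> q" "q \<le> 1"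
  shows "measure_pmf.expectation (random_subset I q) (\<lambda>S. of_bool (e \<in> S \<and> f \<notin> S)) = q * (1 - q)"
proof -
  have "measure_pmf.expectation (random_subset I q) (\<lambda>S. of_bool (f \<notin> S)) = 1 - q"
    by (subst expectation_random_subset_split[OF assms(1,3,5,6)]) simp
  then show ?thesis
    using assms(4) by (subst expectation_random_subset_split[OF assms(1,2,5,6)]) simp
qed

subsection \<open>The random graph\<close>

lemma finite_complete_arcs [simp]: "finite (complete_arcs n)"
  by (rule finite_subset[of _ "Pow {1..n}"]) (auto simp: complete_arcs_def)

lemma random_graph_eq: "random_graph n q = random_subset (complete_arcs n) q"
  by (simp add: random_graph_def random_subset_def)

lemma arc_in_complete_arcs: "i \<in> {1..n} \<Longrightarrow> j \<in> {1..n} \<Longrightarrow> i \<noteq> j \<Longrightarrow> {i, j} \<in> complete_arcs n"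
  by (simp add: complete_arcs_def)

text \<open>The increments from \<open>sum_count_insert_pairs\<close> are summed by linearity over
  all ordered pairs of distinct nodes outside \<open>e\<close>. For each pair, \<open>{k, l}\<close>
  and \<open>{a, l}\<close> are different arcs, so one is present and the other absent with
  probability \<open>q * (1 - q)\<close>.\<close>

lemma expected_increment_ge_pairs:
  assumes e: "e \<in> complete_arcs n" and q: "0 \<le> q" "q \<le> 1"
  shows "q * (1 - q) * real ((n - 2) * (n - 3)) \<le>
    measure_pmf.expectation (random_subset (complete_arcs n) q)
      (\<lambda>S. real (sum_count (insert e S)) - real (sum_count (S - {e})))"
proof -
  obtain a b where ab: "e = {a, b}" "a \<noteq> b" using e by (auto simp: complete_arcs_def card_2_iff)
  with e have abn: "a \<in> {1..n}" "b \<in> {1..n}" by (auto simp: complete_arcs_def)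
  let ?E = "measure_pmf.expectation (random_subset (complete_arcs n) q)"
  define V where "V = {1..n} - {a, b}"
  define Q where "Q = Sigma V (\<lambda>k. V - {k})"
  have cV: "card V = n - 2" and fV: "finite V" using abn ab by (simp_all add: V_def card_Diff_subset)
  have "card Q = (\<Sum>k\<in>V. card (V - {k}))"
    unfolding Q_def using fV by (intro card_SigmaI) auto
  also have "\<dots> = (\<Sum>k\<in>V. n - 3)" using cV fV by (intro sum.cong) auto
  finally have cQ: "card Q = (n - 2) * (n - 3)" using cV by simp
  have fQ: "finite Q" using fV by (simp add: Q_def)
  have "real (card Q) * (q * (1 - q)) = (\<Sum>p\<in>Q. ?E (\<lambda>S. of_bool ({fst p, snd p} \<in> S \<and> {a, snd p} \<notin> S)))"
  proof -
    have "?E (\<lambda>S. of_bool ({fst p, snd p} \<in> S \<and> {a, snd p} \<notin> S)) = q * (1 - q)" if "p \<in> Q" for p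
      using that abn q by (intro expectation_member_nonmember arc_in_complete_arcs)
        (auto simp: Q_def V_def doubleton_eq_iff)
    then show ?thesis by simp
  qed
  also have "\<dots> = ?E (\<lambda>S. \<Sum>p\<in>Q. of_bool ({fst p, snd p} \<in> S \<and> {a, snd p} \<notin> S))"
    by (subst Bochner_Integration.integral_sum) simp_all
  also have "\<dots> \<le> ?E (\<lambda>S. real (sum_count (insert e S)) - real (sum_count (S - {e})))"
  proof (rule expectation_random_subset_mono)
    fix S assume S: "S \<subseteq> complete_arcs n"
    let ?N = "{(k, l). k \<notin> {a, b} \<and> l \<notin> {a, b} \<and> {k, l} \<in> S - {e} \<and> {a, l} \<notin> S - {e}}"
    have "?N \<subseteq> {1..n} \<times> {1..n}" using complete_arcs_endpoints[OF S] by blast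
    then have "finite ?N" by (rule finite_subset) simp
    have "(\<Sum>p\<in>Q. of_bool ({fst p, snd p} \<in> S \<and> {a, snd p} \<notin> S)) = real (card {p\<in>Q. {fst p, snd p} \<in> S \<and> {a, snd p} \<notin> S})"
      using fQ by (simp add: of_bool_def sum.If_cases Int_def)
    also have "{p\<in>Q. {fst p, snd p} \<in> S \<and> {a, snd p} \<notin> S} \<subseteq> ?N"
      by (auto simp: Q_def V_def ab(1) doubleton_eq_iff)
    then have "card {p\<in>Q. {fst p, snd p} \<in> S \<and> {a, snd p} \<notin> S} \<le> card ?N"
      using \<open>finite ?N\<close> by (intro card_mono)
    also have "sum_count (S - {e}) + card ?N \<le> sum_count (insert e S)"
      using sum_count_insert_pairs[of a b "S - {e}" n] S e unfolding ab(1)[symmetric] by (auto simp: insert_absorb)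
    then have "real (card ?N) \<le> real (sum_count (insert e S)) - real (sum_count (S - {e}))" by linarith
    finally show "(\<Sum>p\<in>Q. of_bool ({fst p, snd p} \<in> S \<and> {a, snd p} \<notin> S)) \<le> real (sum_count (insert e S)) - real (sum_count (S - {e}))"
      by simp
  qed simp
  finally show ?thesis by (simp only: cQ mult.commute)
qed

text \<open>A union bound: 1 minus the number of neighbours of \<open>a\<close> other than
  \<open>b\<close> is at most the increment. It is 1 if \<open>a\<close> is isolated apart from
  \<open>e\<close>, and otherwise nonpositive, where monotonicity suffices.\<close>

lemma expected_increment_ge_isolated:
  assumes e: "e \<in> complete_arcs n" and q: "0 \<le> q" "q \<le> 1"
  shows "1 - real n * q \<le>
    measure_pmf.expectation (random_subset (complete_arcs n) q)
      (\<lambda>S. real (sum_count (insert e S)) - real (sum_count (S - {e})))"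
proof -
  obtain a b where ab: "e = {a, b}" "a \<noteq> b" using e by (auto simp: complete_arcs_def card_2_iff)
  with e have abn: "a \<in> {1..n}" "b \<in> {1..n}" by (auto simp: complete_arcs_def)
  let ?E = "measure_pmf.expectation (random_subset (complete_arcs n) q)"
  define V where "V = {1..n} - {a, b}"
  have "card V \<le> n" using card_mono[of "{1..n}" V] by (auto simp: V_def)
  then have "1 - real n * q \<le> 1 - real (card V) * q" using q by (simp add: mult_right_mono)
  also have "\<dots> = 1 - (\<Sum>j\<in>V. ?E (\<lambda>S. of_bool ({a, j} \<in> S)))"
  proof -
    have "?E (\<lambda>S. of_bool ({a, j} \<in> S)) = q" if "j \<in> V" for j
      using that abn q by (intro expectation_member arc_in_complete_arcs) (auto simp: V_def)
    then show ?thesis by simp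
  qed
  also have "\<dots> = ?E (\<lambda>S. 1 - (\<Sum>j\<in>V. of_bool ({a, j} \<in> S)))"
    by (simp add: Bochner_Integration.integral_sum)
  also have "\<dots> \<le> ?E (\<lambda>S. real (sum_count (insert e S)) - real (sum_count (S - {e})))"
  proof (rule expectation_random_subset_mono)
    fix S assume S: "S \<subseteq> complete_arcs n"
    have eS: "insert e (S - {e}) \<subseteq> complete_arcs n" using S e by auto
    have ins: "insert e (S - {e}) = insert e S" by auto
    have mono: "sum_count (S - {e}) \<le> sum_count (insert e S)"
      using sum_count_insert_ge[OF eS, of "{}"] ins by simp
    show "1 - (\<Sum>j\<in>V. of_bool ({a, j} \<in> S)) \<le> real (sum_count (insert e S)) - real (sum_count (S - {e}))"
    proof (cases "\<exists>j\<in>V. {a, j} \<in> S")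
      case True
      then obtain j where "j \<in> V" "{a, j} \<in> S" by blast
      then have "1 \<le> (\<Sum>j\<in>V. of_bool ({a, j} \<in> S) :: real)"
        using member_le_sum[of j V "\<lambda>j. of_bool ({a, j} \<in> S) :: real"] by (simp add: V_def)
      then show ?thesis using mono by simp
    next
      case False
      have "{a, j} \<notin> S - {e}" for j
      proof
        assume j: "{a, j} \<in> S - {e}"
        then have "j \<in> V" using complete_arcs_endpoints[OF S, of a j] ab by (auto simp: V_def)
        then show False using j False by blast
      qed
      then have "sum_count (S - {e}) + 1 \<le> sum_count (insert e S)"
        using sum_count_insert_isolated[of a b "S - {e}" n] eS ins unfolding ab(1)[symmetric] by simp
      moreover have "(\<Sum>j\<in>V. of_bool ({a, j} \<in> S) :: real) = 0" using False by (intro sum.neutral) auto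
      ultimately show ?thesis by linarith
    qed
  qed simp
  finally show ?thesis .
qed

lemma card_complete_arcs_ge:
  assumes "n \<ge> 2"
  shows "real n ^ 2 / 4 \<le> real (card (complete_arcs n))"
proof -
  have "card (complete_arcs n) = n choose 2"
    unfolding complete_arcs_def using n_subsets[OF finite_atLeastAtMost[of 1 n], of 2] by simp
  moreover have "real (2 * (n choose 2)) = real n * (real n - 1)"
  proof -
    have "2 * (n choose 2) = n * (n - 1)"
      unfolding choose_two by (rule dvd_mult_div_cancel) (cases n, simp_all)
    then have "real (2 * (n choose 2)) = real (n * (n - 1))" by (rule arg_cong)
    also have "\<dots> = real n * (real n - 1)" using assms by (simp add: of_nat_diff)
    finally show ?thesis .
  qed
  moreover have "real n * (real n / 2) \<le> real n * (real n - 1)" using assms by (intro mult_left_mono) auto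
  ultimately show ?thesis by (simp add: power2_eq_square)
qed

text \<open>Both regimes of the theorem use this bound, each with its own \<delta>. The constant
  \<open>c\<close> replaces \<open>q\<close> in the factor \<open>1 - q\<close>, so that the factor
  no longer varies with \<open>n\<close>.\<close>

lemma variance_random_graph_ge:
  fixes k :: "nat set set \<Rightarrow> nat"
  assumes k: "\<And>E. E \<subseteq> complete_arcs n \<Longrightarrow> k E = sum_count E"
    and n: "n \<ge> 2" and q: "0 \<le> q" "q \<le> c" "c < 1" and "0 \<le> \<delta>"
    and D: "\<And>e. e \<in> complete_arcs n \<Longrightarrow> \<delta> \<le> measure_pmf.expectation (random_subset (complete_arcs n) q)
      (\<lambda>S. real (sum_count (insert e S)) - real (sum_count (S - {e})))"
  shows "real n ^ 2 / 4 * q * (1 - c) * \<delta>\<^sup>2 \<le> measure_pmf.variance (random_graph n q) (\<lambda>E. real (k E))"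
proof -
  have "real n ^ 2 / 4 * q * (1 - c) * \<delta>\<^sup>2 \<le> real (card (complete_arcs n)) * q * (1 - q) * \<delta>\<^sup>2"
    using card_complete_arcs_ge[OF n] q by (intro mult_right_mono mult_mono) auto
  also have "\<dots> \<le> measure_pmf.variance (random_graph n q) (\<lambda>E. real (k E))"
    unfolding random_graph_eq
  proof (rule variance_random_subset_ge)
    fix e assume e: "e \<in> complete_arcs n"
    have "measure_pmf.expectation (random_subset (complete_arcs n) q) (\<lambda>S. real (k (insert e S)) - real (k (S - {e}))) =
      measure_pmf.expectation (random_subset (complete_arcs n) q)
      (\<lambda>S. real (sum_count (insert e S)) - real (sum_count (S - {e})))"
    proof (rule expectation_random_subset_cong)
      fix S assume "S \<subseteq> complete_arcs n"
      then have "insert e S \<subseteq> complete_arcs n" "S - {e} \<subseteq> complete_arcs n" using e by auto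
      then show "real (k (insert e S)) - real (k (S - {e})) = real (sum_count (insert e S)) - real (sum_count (S - {e}))"
        using k by simp
    qed
    then show "\<delta> \<le> measure_pmf.expectation (random_subset (complete_arcs n) q) (\<lambda>S. real (k (insert e S)) - real (k (S - {e})))"
      using D[OF e] by simp
  qed (use q \<open>0 \<le> \<delta>\<close> in auto)
  finally show ?thesis .
qed

section \<open>From bounds for large \<open>n\<close> to asymptotic relations\<close>

lemma asymp_greatersimI:
  assumes "C > 0" "eventually (\<lambda>n. 0 < b n \<and> C * b n \<le> a n) sequentially"
  shows "a \<greatersim> b"
proof -
  have "eventually (\<lambda>n. ereal C \<le> ereal \<bar>a n / b n\<bar>) sequentially"
    using assms(2)
  proof eventually_elim
    case (elim n)
    then have "C \<le> a n / b n" by (simp add: pos_le_divide_eq)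
    then have "C \<le> \<bar>a n / b n\<bar>" by linarith
    then show ?case by (simp only: ereal_less_eq)
  qed
  then have "ereal C \<le> liminf (\<lambda>n. ereal \<bar>a n / b n\<bar>)" by (rule Liminf_bounded)
  then show ?thesis unfolding asymp_greatersim_def using assms(1) by (metis ereal_less(2) less_le_trans)
qed

theorem theorem4p2:
  fixes p :: "nat \<Rightarrow> real" and K :: "nat \<Rightarrow> nat set set \<Rightarrow> nat"
  assumes p_range: "\<And>n. n \<ge> 1 \<Longrightarrow> 0 < p n \<and> p n < 1"
    and p_limsup: "limsup (\<lambda>n. ereal (p n)) < 1"
    and K_edges: "\<And>n E. E \<subseteq> complete_arcs n \<Longrightarrow>
      \<exists>T. unimodular_triangulation (sym_edge_polytope E) T \<and> K n E = card (triangulation_edges T)"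
  shows "(p \<ggreater> (\<lambda>n. 1 / real n ^ 2) \<longrightarrow>
           (\<lambda>n. measure_pmf.variance (random_graph n (p n)) (\<lambda>E. real (K n E)))
             \<greatersim> (\<lambda>n. real n ^ 6 * p n ^ 3)) \<and>
         (p \<lesssim> (\<lambda>n. 1 / real n ^ 2) \<longrightarrow>
           (\<lambda>n. measure_pmf.variance (random_graph n (p n)) (\<lambda>E. real (K n E)))
             \<greatersim> (\<lambda>n. real n ^ 2 * p n))"
proof -
  \<comment> \<open>\<open>K\<close> may rest on a different triangulation for every graph; the
    count does not depend on that choice.\<close>
  have K: "K n E = sum_count E" if "E \<subseteq> complete_arcs n" for n E
    using K_edges[OF that] triangulation_edges_sym_edge_polytope[OF that] by auto
  obtain c where c: "limsup (\<lambda>n. ereal (p n)) < ereal c" "c < 1"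
    using ereal_dense2[OF p_limsup] by (metis ereal_less(4) less_ereal.simps(1) one_ereal_def)
  have pc: "eventually (\<lambda>n. p n < c) sequentially"
    using Limsup_lessD[OF c(1)] by simp
  let ?V = "\<lambda>n. measure_pmf.variance (random_graph n (p n)) (\<lambda>E. real (K n E))"
  have "?V \<greatersim> (\<lambda>n. real n ^ 6 * p n ^ 3)"
  proof (rule asymp_greatersimI)
    \<comment> \<open>The constant collects \<open>1 / 4\<close> from the number of arcs,
      \<open>(1 / 8)^2\<close> from the square of \<delta>, and three factors
      \<open>1 - c\<close>.\<close>
    show "(1 - c) ^ 3 / 256 > 0" using c by simp
    show "eventually (\<lambda>n. 0 < real n ^ 6 * p n ^ 3 \<and> (1 - c) ^ 3 / 256 * (real n ^ 6 * p n ^ 3) \<le> ?V n) sequentially"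
      using pc eventually_ge_at_top[of 4]
    proof eventually_elim
      case (elim n)
      have p: "0 < p n" "p n < 1" using p_range elim by auto
      define \<delta> where "\<delta> = p n * (1 - c) * (real n ^ 2 / 8)"
      have \<delta>: "\<delta> \<le> p n * (1 - p n) * real ((n - 2) * (n - 3))"
      proof -
        \<comment> \<open>For \<open>n \<ge> 4\<close> one has \<open>n - 2 \<ge> n / 2\<close> and
          \<open>n - 3 \<ge> n / 4\<close>, whence the \<open>n^2 / 8\<close> in \<delta>.\<close>
        have "real n / 2 * (real n / 4) \<le> real (n - 2) * real (n - 3)"
          using elim by (intro mult_mono) (auto simp: of_nat_diff)
        then show ?thesis
          unfolding \<delta>_def using p elim c by (intro mult_mono) (auto simp: power2_eq_square)
      qed
      have "real n ^ 2 / 4 * p n * (1 - c) * \<delta>\<^sup>2 \<le> ?V n"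
      proof (rule variance_random_graph_ge)
        show "0 \<le> \<delta>" using p c by (simp add: \<delta>_def)
        fix e assume "e \<in> complete_arcs n"
        from order_trans[OF \<delta> expected_increment_ge_pairs[OF this]] p
        show "\<delta> \<le> measure_pmf.expectation (random_subset (complete_arcs n) (p n))
          (\<lambda>S. real (sum_count (insert e S)) - real (sum_count (S - {e})))" by linarith
      qed (use elim p c K in auto)
      also have "real n ^ 2 / 4 * p n * (1 - c) * \<delta>\<^sup>2 = (1 - c) ^ 3 / 256 * (real n ^ 6 * p n ^ 3)"
        by (simp add: \<delta>_def field_simps power_numeral_reduce)
      finally show ?case using p(1) elim(2) by (intro conjI) simp_all
    qed
  qed
  moreover have "?V \<greatersim> (\<lambda>n. real n ^ 2 * p n)" if p_small: "p \<lesssim> (\<lambda>n. 1 / real n ^ 2)"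
  proof -
    obtain C where "limsup (\<lambda>n. ereal \<bar>p n / (1 / real n ^ 2)\<bar>) < ereal C"
      using p_small unfolding asymp_lesssim_def by (meson ereal_dense2)
    then have pC: "eventually (\<lambda>n. \<bar>p n / (1 / real n ^ 2)\<bar> < C) sequentially"
      using Limsup_lessD by fastforce
    show ?thesis
    proof (rule asymp_greatersimI)
      \<comment> \<open>Here \<delta> is \<open>1 / 2\<close>, so the constant is
        \<open>1 / 4\<close> times \<open>(1 / 2)^2\<close> times \<open>1 - c\<close>.\<close>
      show "(1 - c) / 16 > 0" using c by simp
      show "eventually (\<lambda>n. 0 < real n ^ 2 * p n \<and> (1 - c) / 16 * (real n ^ 2 * p n) \<le> ?V n) sequentially"
        \<comment> \<open>From \<open>n \<ge> 2 * C\<close> and \<open>n^2 * p n < C\<close> follows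
          \<open>n * p n \<le> 1 / 2\<close>, so the isolated-node bound gives an expected increment
          of at least \<open>1 / 2\<close>.\<close>
        using pc pC eventually_ge_at_top[of "max 2 (nat \<lceil>2 * C\<rceil>)"]
      proof eventually_elim
        case (elim n)
        have n: "n \<ge> 2" "2 * C \<le> real n" using elim(3) by linarith+
        have p: "0 < p n" "p n < 1" using p_range n by auto
        have "real n * (real n * p n) < C"
          using elim(2) p n by (simp add: power2_eq_square abs_mult ac_simps)
        then have "real n * (real n * p n) \<le> real n * (1 / 2)" using n by linarith
        then have np: "real n * p n \<le> 1 / 2" by (rule mult_left_le_imp_le) (use n in simp)
        have "real n ^ 2 / 4 * p n * (1 - c) * (1 / 2)\<^sup>2 \<le> ?V n"
        proof (rule variance_random_graph_ge)
          fix e assume "e \<in> complete_arcs n"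
          from order_trans[OF _ expected_increment_ge_isolated[OF this], of "1 / 2" "p n"] np p
          show "1 / 2 \<le> measure_pmf.expectation (random_subset (complete_arcs n) (p n))
            (\<lambda>S. real (sum_count (insert e S)) - real (sum_count (S - {e})))" by linarith
        qed (use elim(1) p c n K in auto)
        then show ?case using p n by (simp add: power2_eq_square field_simps)
      qed
    qed
  qed
  ultimately show ?thesis by blast
qed

end
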